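(* Let $V$ be an absolute matrix order unit space satisfying the following condition (T): for all $l,m,n\in\mathbb{N}$, if $u \in \mathcal{PI}_{m,n}(V)$ and $v \in \mathcal{PI}_{l,n}(V)$ with $\vert u \vert_{m,n} = \vert v \vert_{l,n}$, then there exists $w \in \mathcal{PI}_{m,l}(V)$ such that $\vert w^* \vert_{l,m} = \vert u^* \vert_{n,m}$ and $\vert w \vert_{m,l} = \vert v^* \vert_{n,l}$. Let $p \in \mathcal{OP}_n(V) \setminus \lbrace 0 \rbrace$ for some $n \in \mathbb{N}$, and let $k\in\mathbb{N}$ be arbitrary. Then the following statements are equivalent: (1) $p$ is an infinite projection; (2) there exist $q, r \in \mathcal{OP}_n(V) \setminus \lbrace 0 \rbrace$ with $q \perp r$ such that $p = q + r$ and $p \sim q$; (3) $p \oplus 0_k$ is an infinite projection; (4) $0_k \oplus p$ is an infinite projection; (5) $\alpha p \alpha^*$ is an infinite projection whenever $m\in\mathbb{N}$ and $\alpha \in M_{m,n}$ with $\alpha^* \alpha = I_n$. Moreover, if $V$ also satisfies the condition (H): for all $m,n\in\mathbb{N}$, if $u \in \mathcal{PI}_{m,n}(V)$ and $p' \in \mathcal{OP}_n(V)$ with $p' \le \vert u \vert_{m,n}$, then there exists $u_1 \in \mathcal{PI}_{m,n}(V)$ with $u_1 \perp (u - u_1)$ such that $p' = \vert u_1 \vert_{m,n}$; then statements (1), (2), (3), (4) and (5) are also equivalent to: (6) $p \oplus q \preceq p$ for some $q \in \mathcal{OP}_\infty(V) \setminus \lbrace 0 \rbrace$.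
   Context: A real ordered vector space $(E,E^+)$ is a real vector space with a cone $E^+$ (closed under addition and multiplication by nonnegative scalars); $u \le v$ means $v-u \in E^+$. It is an absolutely ordered space if there is a map $\vert\cdot\vert : E \to E^+$ such that: (1) $\vert v\vert = v$ if $v \in E^+$; (2) $\vert v \vert \pm v \in E^+$ for all $v$; (3) $\vert kv\vert = \vert k\vert \vert v\vert$ for $k \in \mathbb{R}$; (4) if $\vert u-v\vert = u+v$ and $0 \le w \le v$, then $\vert u-w\vert = u+w$; (5) if $\vert u-v\vert = u+v$ and $\vert u-w\vert = u+w$, then $\vert u - \vert v\pm w\vert\vert = u + \vert v \pm w\vert$. In it, $u\perp v$ means $\vert\,\vert u\vert-\vert v\vert\,\vert=\vert u\vert+\vert v\vert$. For a $*$-vector space $V$ (complex vector space with conjugate-linear involution), $M_{m,n}(V)$ is the space of $m\times n$ matrices over $V$, $M_{m,n}=M_{m,n}(\mathbb{C})$ with the operator norm, $M_n(V)=M_{n,n}(V)$, $[v_{ij}]^*=[v_{ji}^*]$, $M_n(V)_{sa}$ is the set of self-adjoint elements, $v\oplus w=\begin{bmatrix} v&0\\0&w\end{bmatrix}$, $0_k$ is the zero of $M_k(V)$, and $I_n$ is the identity of $M_n=M_{n,n}$. A matrix ordered space is a $*$-vector space $V$ with cones $M_n(V)^+\subset M_n(V)_{sa}$ ($n\in\mathbb{N}$) such that each $(M_n(V)_{sa},M_n(V)^+)$ is a real ordered vector space and $\alpha^*v\alpha\in M_m(V)^+$ for all $v\in M_n(V)^+$, $\alpha\in M_{n,m}$;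 write $V^+=M_1(V)^+$. An absolutely matrix ordered space is a matrix ordered space with maps $\vert\cdot\vert_{m,n}:M_{m,n}(V)\to M_n(V)^+$ (write $\vert\cdot\vert_n=\vert\cdot\vert_{n,n}$) such that: (i) each $(M_n(V)_{sa},M_n(V)^+,\vert\cdot\vert_n)$ is an absolutely ordered space; (ii) $\vert\alpha v\beta\vert_{r,s}\le\|\alpha\|\,\vert\,\vert v\vert_{m,n}\beta\vert_{n,s}$ for $v\in M_{m,n}(V)$, $\alpha\in M_{r,m}$, $\beta\in M_{n,s}$; (iii) $\vert v\oplus w\vert_{m+r,n+s}=\vert v\vert_{m,n}\oplus\vert w\vert_{r,s}$ for $v\in M_{m,n}(V)$, $w\in M_{r,s}(V)$. For $u,v\in M_{m,n}(V)$, $u\perp v$ means $\begin{bmatrix}0&u\\ u^*&0\end{bmatrix}\perp\begin{bmatrix}0&v\\ v^*&0\end{bmatrix}$ in $M_{m+n}(V)_{sa}$. A matrix order unit space $(V,e)$ is a matrix ordered space with an order unit $e\in V^+$ (for each $v\in V_{sa}$ there is $k>0$ with $ke\pm v\in V^+$) such that $V^+\cap(-V^+)=\{0\}$ and each $M_n(V)^+$ is Archimedean (if $u,v\in M_n(V)_{sa}$ and $v+ku\in M_n(V)^+$ for all $k>0$ then $v\in M_n(V)^+$). Put $e^n=e\oplus\cdots\oplus e\in M_n(V)$; the norm on $M_n(V)$ is $\|v\|_n=\inf\{k>0:\begin{bmatrix}ke^n&v\\ v^*&ke^n\end{bmatrix}\in M_{2n}(V)^+\}$. For $u,v\in M_n(V)_{sa}$,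 $u\perp_\infty v$ means $\|u+kv\|_n=\max\{\|u\|_n,\|kv\|_n\}$ for all $k\in\mathbb{R}$. For $u,v\in M_n(V)^+$, $u\perp_\infty^a v$ means $u_1\perp_\infty v_1$ whenever $0\le u_1\le u$ and $0\le v_1\le v$. An absolute matrix order unit space is a matrix order unit space that is an absolutely matrix ordered space and in which $\perp=\perp_\infty^a$ on $M_n(V)^+$ for all $n$. An order projection in $M_n(V)$ is $p=p^*\in M_n(V)$ with $\vert 2p-e^n\vert_n=e^n$; $\mathcal{OP}_n(V)$ is the set of these, and $\mathcal{OP}_\infty(V)=\{p: p\in\mathcal{OP}_n(V)\text{ for some }n\in\mathbb{N}\}$; $\mathcal{OP}_\infty(V)\setminus\{0\}$ means that zero matrices of all sizes are removed. $v\in M_{m,n}(V)$ is a partial isometry if $\vert v\vert_{m,n}\in\mathcal{OP}_n(V)$ and $\vert v^*\vert_{n,m}\in\mathcal{OP}_m(V)$; $\mathcal{PI}_{m,n}(V)$ is the set of these. For $p\in\mathcal{OP}_m(V)$, $q\in\mathcal{OP}_n(V)$, $p\sim q$ means there is $v\in\mathcal{PI}_{m,n}(V)$ with $p=\vert v^*\vert_{n,m}$ and $q=\vert v\vert_{m,n}$. For $p,q\in\mathcal{OP}_\infty(V)$, $p\preceq q$ means there is $r\in\mathcal{OP}_\infty(V)$ (of the same matrix size as $q$) with $p\sim r\le q$. $p\in\mathcal{OP}_n(V)$ is infinite if there is $q\in\mathcal{OP}_n(V)$ with $q\le p$, $q\ne p$ and $p\sim q$. *)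

theory Defs
  imports "Jordan_Normal_Form.Schur_Decomposition"
begin

(* Matrices over V are Jordan_Normal_Form matrices: they carry their dimensions, so one
   function mabs represents the whole family of maps |.|_{m,n}.  Matrix sizes are
   positive throughout; matrices with no rows or no columns also exist in 'v mat, hence
   the guards 0 < n.  The carrier of V is the whole type 'v. *)

record 'v matrix_space =
  vscale :: "complex \<Rightarrow> 'v \<Rightarrow> 'v"
  vstar :: "'v \<Rightarrow> 'v"
  mcone :: "nat \<Rightarrow> 'v mat set"
  mabs :: "'v mat \<Rightarrow> 'v mat"
  ounit :: 'v

(* E is understood to be a real vector space under +, - and the scalar multiplication sc.
   This is automatic for the sets of self-adjoint matrices, the only use below. *)

definition real_ordered_space :: "'a::plus set \<Rightarrow> 'a set \<Rightarrow> (real \<Rightarrow> 'a \<Rightarrow> 'a) \<Rightarrow> bool" where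
  "real_ordered_space E P sc \<longleftrightarrow>
     P \<subseteq> E \<and> P \<noteq> {} \<and>
     (\<forall>u\<in>P. \<forall>v\<in>P. u + v \<in> P) \<and>
     (\<forall>k\<ge>0. \<forall>v\<in>P. sc k v \<in> P)"

definition absolutely_ordered_space ::
  "'a::{plus,minus} set \<Rightarrow> 'a set \<Rightarrow> (real \<Rightarrow> 'a \<Rightarrow> 'a) \<Rightarrow> ('a \<Rightarrow> 'a) \<Rightarrow> bool" where
  "absolutely_ordered_space E P sc ab \<longleftrightarrow>
     real_ordered_space E P sc \<and>
     (\<forall>v\<in>E. ab v \<in> P) \<and>
     (\<forall>v\<in>P. ab v = v) \<and>
     (\<forall>v\<in>E. ab v + v \<in> P \<and> ab v - v \<in> P) \<and>
     (\<forall>k. \<forall>v\<in>E. ab (sc k v) = sc \<bar>k\<bar> (ab v)) \<and>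
     (\<forall>u\<in>E. \<forall>v\<in>E. \<forall>w\<in>E.
        ab (u - v) = u + v \<and> w \<in> P \<and> v - w \<in> P \<longrightarrow> ab (u - w) = u + w) \<and>
     (\<forall>u\<in>E. \<forall>v\<in>E. \<forall>w\<in>E.
        ab (u - v) = u + v \<and> ab (u - w) = u + w \<longrightarrow>
          ab (u - ab (v + w)) = u + ab (v + w) \<and>
          ab (u - ab (v - w)) = u + ab (v - w))"

definition ao_orthogonal :: "('a::{plus,minus} \<Rightarrow> 'a) \<Rightarrow> 'a \<Rightarrow> 'a \<Rightarrow> bool" where
  "ao_orthogonal ab u v \<longleftrightarrow> ab (ab u - ab v) = ab u + ab v"

definition mstar :: "'v matrix_space \<Rightarrow> 'v mat \<Rightarrow> 'v mat" where
  "mstar V v = mat (dim_col v) (dim_row v) (\<lambda>(i,j). vstar V (v $$ (j,i)))"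

definition Msa :: "'v matrix_space \<Rightarrow> nat \<Rightarrow> 'v mat set" where
  "Msa V n = {v \<in> carrier_mat n n. mstar V v = v}"

definition rscale :: "'v matrix_space \<Rightarrow> real \<Rightarrow> 'v mat \<Rightarrow> 'v mat" where
  "rscale V k v = map_mat (vscale V (complex_of_real k)) v"

definition lmul :: "'v::comm_monoid_add matrix_space \<Rightarrow> complex mat \<Rightarrow> 'v mat \<Rightarrow> 'v mat" where
  "lmul V \<alpha> v = mat (dim_row \<alpha>) (dim_col v)
     (\<lambda>(i,j). \<Sum>k<dim_col \<alpha>. vscale V (\<alpha> $$ (i,k)) (v $$ (k,j)))"

definition rmul :: "'v::comm_monoid_add matrix_space \<Rightarrow> 'v mat \<Rightarrow> complex mat \<Rightarrow> 'v mat" where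
  "rmul V v \<beta> = mat (dim_row v) (dim_col \<beta>)
     (\<lambda>(i,j). \<Sum>k<dim_row \<beta>. vscale V (\<beta> $$ (k,j)) (v $$ (i,k)))"

definition dsum :: "'v::zero mat \<Rightarrow> 'v mat \<Rightarrow> 'v mat" where
  "dsum v w = four_block_mat v (0\<^sub>m (dim_row v) (dim_col w)) (0\<^sub>m (dim_row w) (dim_col v)) w"

definition sa_dilation :: "'v::zero matrix_space \<Rightarrow> 'v mat \<Rightarrow> 'v mat" where
  "sa_dilation V u =
     four_block_mat (0\<^sub>m (dim_row u) (dim_row u)) u (mstar V u) (0\<^sub>m (dim_col u) (dim_col u))"

definition vec_norm2 :: "complex vec \<Rightarrow> real" where
  "vec_norm2 x = sqrt (\<Sum>i<dim_vec x. (cmod (x $ i))\<^sup>2)"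

definition op_norm :: "complex mat \<Rightarrow> real" where
  "op_norm \<alpha> = (SUP x \<in> {x \<in> carrier_vec (dim_col \<alpha>). vec_norm2 x \<le> 1}. vec_norm2 (\<alpha> *\<^sub>v x))"

definition mle :: "'v::minus matrix_space \<Rightarrow> nat \<Rightarrow> 'v mat \<Rightarrow> 'v mat \<Rightarrow> bool" where
  "mle V n u v \<longleftrightarrow> u \<in> Msa V n \<and> v \<in> Msa V n \<and> v - u \<in> mcone V n"

(* The orthogonality of elements of M_{m,n}(V).  On self-adjoint matrices of the same size,
   "ao_orthogonal (mabs V)" is the orthogonality of the absolutely ordered space M_n(V)_sa. *)
definition morthogonal :: "'v::{zero,plus,minus} matrix_space \<Rightarrow> 'v mat \<Rightarrow> 'v mat \<Rightarrow> bool" where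
  "morthogonal V u v \<longleftrightarrow> ao_orthogonal (mabs V) (sa_dilation V u) (sa_dilation V v)"

(* M_1(V) is identified with V. *)
definition mat1 :: "'v \<Rightarrow> 'v mat" where
  "mat1 v = mat 1 1 (\<lambda>_. v)"

definition Vpos :: "'v matrix_space \<Rightarrow> 'v set" where
  "Vpos V = {v. mat1 v \<in> mcone V 1}"

definition munit :: "'v::zero matrix_space \<Rightarrow> nat \<Rightarrow> 'v mat" where
  "munit V n = mat n n (\<lambda>(i,j). if i = j then ounit V else 0)"

definition mnorm :: "'v::zero matrix_space \<Rightarrow> nat \<Rightarrow> 'v mat \<Rightarrow> real" where
  "mnorm V n v = Inf {k. k > 0 \<and>
     four_block_mat (rscale V k (munit V n)) v (mstar V v) (rscale V k (munit V n)) \<in> mcone V (2 * n)}"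

definition orthogonal_inf :: "'v::{zero,plus} matrix_space \<Rightarrow> nat \<Rightarrow> 'v mat \<Rightarrow> 'v mat \<Rightarrow> bool" where
  "orthogonal_inf V n u v \<longleftrightarrow>
     (\<forall>k::real. mnorm V n (u + rscale V k v) = max (mnorm V n u) (mnorm V n (rscale V k v)))"

definition abs_orthogonal_inf ::
  "'v::{zero,plus,minus} matrix_space \<Rightarrow> nat \<Rightarrow> 'v mat \<Rightarrow> 'v mat \<Rightarrow> bool" where
  "abs_orthogonal_inf V n u v \<longleftrightarrow>
     (\<forall>u1 v1. mle V n (0\<^sub>m n n) u1 \<and> mle V n u1 u \<and> mle V n (0\<^sub>m n n) v1 \<and> mle V n v1 v
        \<longrightarrow> orthogonal_inf V n u1 v1)"

locale star_vector_space =
  fixes V :: "'v::ab_group_add matrix_space"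
  assumes vector_space: "vector_space (vscale V)"
    and star_star: "vstar V (vstar V x) = x"
    and star_add: "vstar V (x + y) = vstar V x + vstar V y"
    and star_scale: "vstar V (vscale V c x) = vscale V (cnj c) (vstar V x)"

locale matrix_ordered_space = star_vector_space V
  for V :: "'v::ab_group_add matrix_space" +
  assumes ordered: "0 < n \<Longrightarrow> real_ordered_space (Msa V n) (mcone V n) (rscale V)"
    and compress: "\<lbrakk>0 < m; 0 < n; v \<in> mcone V n; \<alpha> \<in> carrier_mat n m\<rbrakk>
      \<Longrightarrow> rmul V (lmul V (mat_adjoint \<alpha>) v) \<alpha> \<in> mcone V m"

locale absolutely_matrix_ordered_space = matrix_ordered_space V
  for V :: "'v::ab_group_add matrix_space" +
  assumes mabs_cone: "\<lbrakk>0 < m; 0 < n; v \<in> carrier_mat m n\<rbrakk> \<Longrightarrow> mabs V v \<in> mcone V n"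
    and absolutely_ordered:
      "0 < n \<Longrightarrow> absolutely_ordered_space (Msa V n) (mcone V n) (rscale V) (mabs V)"
    and mabs_mul: "\<lbrakk>0 < m; 0 < n; 0 < r; 0 < s;
        v \<in> carrier_mat m n; \<alpha> \<in> carrier_mat r m; \<beta> \<in> carrier_mat n s\<rbrakk>
      \<Longrightarrow> mle V s (mabs V (rmul V (lmul V \<alpha> v) \<beta>))
                  (rscale V (op_norm \<alpha>) (mabs V (rmul V (mabs V v) \<beta>)))"
    and mabs_dsum: "\<lbrakk>0 < m; 0 < n; 0 < r; 0 < s; v \<in> carrier_mat m n; w \<in> carrier_mat r s\<rbrakk>
      \<Longrightarrow> mabs V (dsum v w) = dsum (mabs V v) (mabs V w)"

locale matrix_order_unit_space = matrix_ordered_space V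
  for V :: "'v::ab_group_add matrix_space" +
  assumes unit_pos: "ounit V \<in> Vpos V"
    and order_unit: "vstar V x = x \<Longrightarrow> \<exists>k>0.
      vscale V (complex_of_real k) (ounit V) + x \<in> Vpos V \<and>
      vscale V (complex_of_real k) (ounit V) - x \<in> Vpos V"
    and proper: "Vpos V \<inter> uminus ` Vpos V = {0}"
    and archimedean: "\<lbrakk>0 < n; u \<in> Msa V n; v \<in> Msa V n;
        \<And>k. k > 0 \<Longrightarrow> v + rscale V k u \<in> mcone V n\<rbrakk> \<Longrightarrow> v \<in> mcone V n"

locale absolute_matrix_order_unit_space =
  matrix_order_unit_space V + absolutely_matrix_ordered_space V
  for V :: "'v::ab_group_add matrix_space" +
  assumes orthogonal_eq: "\<lbrakk>0 < n; u \<in> mcone V n; v \<in> mcone V n\<rbrakk>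
      \<Longrightarrow> ao_orthogonal (mabs V) u v \<longleftrightarrow> abs_orthogonal_inf V n u v"

definition OP :: "'v::{zero,minus} matrix_space \<Rightarrow> nat \<Rightarrow> 'v mat set" where
  "OP V n = {p \<in> carrier_mat n n. mstar V p = p \<and> mabs V (rscale V 2 p - munit V n) = munit V n}"

definition OPinf :: "'v::{zero,minus} matrix_space \<Rightarrow> 'v mat set" where
  "OPinf V = (\<Union>n\<in>{0<..}. OP V n)"

definition zero_matrices :: "'v::zero mat set" where
  "zero_matrices = {0\<^sub>m m n |m n. True}"

definition ParIso :: "'v::{zero,minus} matrix_space \<Rightarrow> nat \<Rightarrow> nat \<Rightarrow> 'v mat set" where
  "ParIso V m n = {v \<in> carrier_mat m n. mabs V v \<in> OP V n \<and> mabs V (mstar V v) \<in> OP V m}"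

definition proj_equiv :: "'v::{zero,minus} matrix_space \<Rightarrow> 'v mat \<Rightarrow> 'v mat \<Rightarrow> bool" where
  "proj_equiv V p q \<longleftrightarrow>
     (\<exists>v \<in> ParIso V (dim_row p) (dim_row q). p = mabs V (mstar V v) \<and> q = mabs V v)"

definition proj_subequiv :: "'v::{zero,minus} matrix_space \<Rightarrow> 'v mat \<Rightarrow> 'v mat \<Rightarrow> bool" where
  "proj_subequiv V p q \<longleftrightarrow>
     (\<exists>r \<in> OP V (dim_row q). proj_equiv V p r \<and> mle V (dim_row q) r q)"

definition infinite_projection :: "'v::{zero,minus} matrix_space \<Rightarrow> 'v mat \<Rightarrow> bool" where
  "infinite_projection V p \<longleftrightarrow> p \<in> OPinf V \<and>
     (\<exists>q \<in> OP V (dim_row p). mle V (dim_row p) q p \<and> q \<noteq> p \<and> proj_equiv V p q)"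

definition condition_T :: "'v::{zero,minus} matrix_space \<Rightarrow> bool" where
  "condition_T V \<longleftrightarrow> (\<forall>l>0. \<forall>m>0. \<forall>n>0. \<forall>u \<in> ParIso V m n. \<forall>v \<in> ParIso V l n.
     mabs V u = mabs V v \<longrightarrow>
       (\<exists>w \<in> ParIso V m l. mabs V (mstar V w) = mabs V (mstar V u) \<and> mabs V w = mabs V (mstar V v)))"

definition condition_H :: "'v::{zero,plus,minus} matrix_space \<Rightarrow> bool" where
  "condition_H V \<longleftrightarrow> (\<forall>m>0. \<forall>n>0. \<forall>u \<in> ParIso V m n. \<forall>p \<in> OP V n.
     mle V n p (mabs V u) \<longrightarrow>
       (\<exists>u1 \<in> ParIso V m n. morthogonal V u1 (u - u1) \<and> p = mabs V u1))"

end

theory Submission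
  imports Defs
begin

text \<open>
  Everything rests on one behaviour of the absolute value: left multiplication by an isometry \<open>A\<close> does
  not change it (\<open>mabs_lmul_isometry\<close>), because \<open>A\<close> and its left inverse \<open>A\<^sup>*\<close> are contractions.  Hence
  \<open>|U w U\<^sup>*| = U |w| U\<^sup>*\<close> for unitary \<open>U\<close> (\<open>mabs_unitary_conj\<close>); with Halmos' unitary, \<open>A p A\<^sup>*\<close> is an
  order projection iff \<open>p\<close> is (\<open>OP_conj_by_iff\<close>), and \<open>p A\<^sup>*\<close> is a partial isometry implementing the
  equivalence of \<open>p\<close> and \<open>A p A\<^sup>*\<close> (\<open>proj_equiv_conj_by\<close>).  A projection below \<open>A p A\<^sup>*\<close> is of the form
  \<open>A q A\<^sup>*\<close> (\<open>below_conj_by\<close>).  Under condition (T) equivalence is transitive, and so \<open>p\<close> is infinite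
  iff \<open>A p A\<^sup>*\<close> is (\<open>infinite_projection_conj_by_iff\<close>).  Both \<open>p \<oplus> 0\<close> and \<open>0 \<oplus> p\<close> are special cases.

  If \<open>q \<le> p\<close> are projections, then \<open>p - q\<close> is a projection orthogonal to \<open>q\<close> (\<open>OP_diff\<close>), which gives the
  splitting \<open>p = q + r\<close> of an infinite projection.  That \<open>q \<noteq> 0\<close> uses that \<open>|v| = 0\<close> implies \<open>v = 0\<close>
  (\<open>mabs_eq_0D\<close>), a consequence of the identity that the self-adjoint dilation of \<open>v\<close> has absolute
  value \<open>|v\<^sup>*| \<oplus> |v|\<close> (\<open>mabs_sa_dilation\<close>) and of the Archimedean property (\<open>cone_null\<close>).

  The same identity transfers additivity of the absolute value on orthogonal elements from self-adjoint to
  rectangular matrices (\<open>mabs_add_morthogonal\<close>).  This shows that \<open>p \<oplus> r\<close> is equivalent to \<open>q + r\<close> if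
  \<open>p\<close> is equivalent to \<open>q\<close> and \<open>q\<close> is orthogonal to \<open>r\<close> (\<open>proj_equiv_dsum_add\<close>), and, under condition (H),
  that a partial isometry from \<open>p \<oplus> q\<close> into \<open>p\<close> with \<open>q \<noteq> 0\<close> restricts to one from \<open>p\<close> onto a proper
  subprojection of \<open>p\<close> (\<open>infinite_if_dsum_subequiv\<close>).
\<close>


section \<open>Scalar matrices: isometries and contractions\<close>

lemma mat_adjoint_carrier [simp]: "A \<in> carrier_mat r c \<Longrightarrow> mat_adjoint A \<in> carrier_mat c r"
  unfolding mat_adjoint_def by auto

lemma mat_adjoint_dim [simp]:
  "dim_row (mat_adjoint A) = dim_col A" "dim_col (mat_adjoint A) = dim_row A"
  unfolding mat_adjoint_def by auto

lemma mat_adjoint_index [simp]: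
  fixes A :: "complex mat"
  assumes "i < dim_col A" "j < dim_row A"
  shows "mat_adjoint A $$ (i,j) = cnj (A $$ (j,i))"
  using assms unfolding mat_adjoint_def by (simp add: mat_of_rows_index)

lemma mat_adjoint_adjoint [simp]:
  fixes A :: "complex mat"
  shows "mat_adjoint (mat_adjoint A) = A"
  by (rule eq_matI) auto

lemma mat_adjoint_mult:
  fixes A B :: "complex mat"
  assumes "A \<in> carrier_mat r m" "B \<in> carrier_mat m c"
  shows "mat_adjoint (A * B) = mat_adjoint B * mat_adjoint A"
  using assms by (intro eq_matI) (auto simp: scalar_prod_def mult.commute)

lemma mat_adjoint_one [simp]: "mat_adjoint (1\<^sub>m n :: complex mat) = 1\<^sub>m n"
  by (rule eq_matI) auto

lemma mat_adjoint_zero [simp]: "mat_adjoint (0\<^sub>m r c :: complex mat) = 0\<^sub>m c r"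
  by (rule eq_matI) auto

text \<open>The next two lemmas: if \<open>B\<^sup>* B + C\<^sup>* C = 1\<close> then \<open>\<parallel>B x\<parallel>\<^sup>2 + \<parallel>C x\<parallel>\<^sup>2 = \<parallel>x\<parallel>\<^sup>2\<close>, so \<open>B\<close> is a contraction.\<close>

lemma complex_norm_sq_mult_mat_vec:
  fixes B :: "complex mat"
  assumes "B \<in> carrier_mat m n" "x \<in> carrier_vec n"
  shows "complex_of_real (\<Sum>i<m. (cmod ((B *\<^sub>v x) $ i))\<^sup>2)
    = (\<Sum>j<n. \<Sum>k<n. x $ j * cnj (x $ k) * (mat_adjoint B * B) $$ (k,j))"
proof -
  have "complex_of_real (\<Sum>i<m. (cmod ((B *\<^sub>v x) $ i))\<^sup>2)
     = (\<Sum>i<m. (\<Sum>j<n. B $$ (i,j) * x $ j) * (\<Sum>k<n. cnj (B $$ (i,k)) * cnj (x $ k)))"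
    unfolding of_real_sum
  proof (intro sum.cong refl)
    fix i assume "i \<in> {..<m}"
    then have i: "(B *\<^sub>v x) $ i = (\<Sum>j<n. B $$ (i,j) * x $ j)"
      using assms by (auto simp: scalar_prod_def atLeast0LessThan intro!: sum.cong)
    show "complex_of_real ((cmod ((B *\<^sub>v x) $ i))\<^sup>2)
        = (\<Sum>j<n. B $$ (i,j) * x $ j) * (\<Sum>k<n. cnj (B $$ (i,k)) * cnj (x $ k))"
      unfolding complex_norm_square of_real_power[symmetric] i by simp
  qed
  also have "\<dots> = (\<Sum>i<m. \<Sum>j<n. \<Sum>k<n. x $ j * cnj (x $ k) * (cnj (B $$ (i,k)) * B $$ (i,j)))"
    unfolding sum_product by (intro sum.cong refl) (simp only: mult_ac)
  also have "\<dots> = (\<Sum>j<n. \<Sum>i<m. \<Sum>k<n. x $ j * cnj (x $ k) * (cnj (B $$ (i,k)) * B $$ (i,j)))"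
    by (rule sum.swap)
  also have "\<dots> = (\<Sum>j<n. \<Sum>k<n. \<Sum>i<m. x $ j * cnj (x $ k) * (cnj (B $$ (i,k)) * B $$ (i,j)))"
    by (rule sum.cong[OF refl], rule sum.swap)
  also have "\<dots> = (\<Sum>j<n. \<Sum>k<n. x $ j * cnj (x $ k) * (mat_adjoint B * B) $$ (k,j))"
    using assms
    by (intro sum.cong refl) (auto simp: scalar_prod_def atLeast0LessThan sum_distrib_left intro!: sum.cong)
  finally show ?thesis .
qed

lemma op_norm_le_1:
  fixes B C :: "complex mat"
  assumes B: "B \<in> carrier_mat m n" and C: "C \<in> carrier_mat r n"
    and BC: "mat_adjoint B * B + mat_adjoint C * C = 1\<^sub>m n"
  shows "op_norm B \<le> 1"
proof -
  have le: "vec_norm2 (B *\<^sub>v x) \<le> vec_norm2 x" if x: "x \<in> carrier_vec n" for x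
  proof -
    let ?b = "\<Sum>i<m. (cmod ((B *\<^sub>v x) $ i))\<^sup>2" and ?c = "\<Sum>i<r. (cmod ((C *\<^sub>v x) $ i))\<^sup>2"
    have "complex_of_real (?b + ?c)
        = (\<Sum>j<n. \<Sum>k<n. x $ j * cnj (x $ k) * (mat_adjoint B * B + mat_adjoint C * C) $$ (k,j))"
      unfolding of_real_add complex_norm_sq_mult_mat_vec[OF B x]
        complex_norm_sq_mult_mat_vec[OF C x] sum.distrib[symmetric]
    proof (intro sum.cong refl)
      fix j k assume "j \<in> {..<n}" "k \<in> {..<n}"
      then have "(mat_adjoint B * B + mat_adjoint C * C) $$ (k,j)
          = (mat_adjoint B * B) $$ (k,j) + (mat_adjoint C * C) $$ (k,j)"
        using B C by (intro index_add_mat(1)) auto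
      then show "x $ j * cnj (x $ k) * (mat_adjoint B * B) $$ (k,j)
          + x $ j * cnj (x $ k) * (mat_adjoint C * C) $$ (k,j)
          = x $ j * cnj (x $ k) * (mat_adjoint B * B + mat_adjoint C * C) $$ (k,j)"
        by (simp only: distrib_left)
    qed
    also have "\<dots> = (\<Sum>j<n. \<Sum>k<n. if k = j then x $ j * cnj (x $ k) else 0)"
      unfolding BC by (intro sum.cong refl) auto
    also have "\<dots> = complex_of_real (\<Sum>j<n. (cmod (x $ j))\<^sup>2)"
      by (simp add: complex_norm_square del: of_real_power)
    finally have "?b + ?c = (\<Sum>j<n. (cmod (x $ j))\<^sup>2)"
      by (simp only: of_real_eq_iff)
    moreover have "?c \<ge> 0" by (intro sum_nonneg) auto
    ultimately show ?thesis
      using B x unfolding vec_norm2_def by auto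
  qed
  have "vec_norm2 (0\<^sub>v n) \<le> 1" by (simp add: vec_norm2_def)
  then have "{x \<in> carrier_vec (dim_col B). vec_norm2 x \<le> 1} \<noteq> {}"
    using B zero_carrier_vec[of n] by blast
  then show ?thesis
    unfolding op_norm_def using B by (intro cSUP_least) (auto intro: order_trans[OF le])
qed

lemma isometry_op_norm_le_1:
  fixes A :: "complex mat"
  assumes A: "A \<in> carrier_mat m n" and iso: "mat_adjoint A * A = 1\<^sub>m n"
  shows "op_norm A \<le> 1"
  by (rule op_norm_le_1[OF A, of "0\<^sub>m n n" n]) (auto simp: iso)

text \<open>The projection \<open>1 - A A\<^sup>*\<close> onto the orthogonal complement of the range of an isometry \<open>A\<close>.\<close>

lemma defect_projection:
  fixes A :: "complex mat"
  assumes A: "A \<in> carrier_mat m n" and iso: "mat_adjoint A * A = 1\<^sub>m n"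
  defines "D \<equiv> 1\<^sub>m m - A * mat_adjoint A"
  shows "D \<in> carrier_mat m m" "mat_adjoint D = D" "D * A = 0\<^sub>m m n"
    "mat_adjoint A * D = 0\<^sub>m n m" "D * D = D" "D * D + A * mat_adjoint A = 1\<^sub>m m"
proof -
  have A': "mat_adjoint A \<in> carrier_mat n m" using A by simp
  have AA: "A * mat_adjoint A \<in> carrier_mat m m" using A by simp
  show D: "D \<in> carrier_mat m m" unfolding D_def using A by auto
  show adj: "mat_adjoint D = D"
  proof (rule eq_matI)
    fix i j assume "i < dim_row D" "j < dim_col D"
    then show "mat_adjoint D $$ (i,j) = D $$ (i,j)"
      using D A unfolding D_def by (auto simp: scalar_prod_def mult.commute)
  qed (use D in auto)
  have "D * A = 1\<^sub>m m * A - A * mat_adjoint A * A"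
    unfolding D_def by (rule minus_mult_distrib_mat[OF _ AA A]) simp
  also have "A * mat_adjoint A * A = A * (mat_adjoint A * A)"
    by (rule assoc_mult_mat[OF A A' A])
  finally show DA: "D * A = 0\<^sub>m m n" using A by (auto simp: iso)
  have "mat_adjoint (D * A) = mat_adjoint A * D"
    using mat_adjoint_mult[OF D A] by (simp add: adj)
  then show "mat_adjoint A * D = 0\<^sub>m n m" by (simp add: DA)
  have DAA: "D * (A * mat_adjoint A) = 0\<^sub>m m m"
    using assoc_mult_mat[OF D A A'] A by (simp add: DA)
  have "D * D = D * 1\<^sub>m m - D * (A * mat_adjoint A)"
    using mult_minus_distrib_mat[OF D _ AA, of "1\<^sub>m m"] by (simp add: D_def)
  then show DD: "D * D = D" using D by (auto simp: DAA)
  show "D * D + A * mat_adjoint A = 1\<^sub>m m"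
    unfolding DD using A by (intro eq_matI) (auto simp: D_def)
qed

lemma coisometry_op_norm_le_1:
  fixes A :: "complex mat"
  assumes A: "A \<in> carrier_mat m n" and iso: "mat_adjoint A * A = 1\<^sub>m n"
  shows "op_norm (mat_adjoint A) \<le> 1"
proof -
  note D = defect_projection[OF A iso]
  let ?D = "1\<^sub>m m - A * mat_adjoint A"
  have "A * mat_adjoint A + ?D * ?D = 1\<^sub>m m"
    using D(6) comm_add_mat[of "?D * ?D" m m "A * mat_adjoint A"] A D(1)
    by (metis mat_adjoint_carrier mult_carrier_mat)
  then show ?thesis
    using op_norm_le_1[of "mat_adjoint A" n m ?D m] A D(1,2) by simp
qed

text \<open>The inclusions of the first \<open>m\<close> and of the last \<open>n\<close> coordinates into \<open>m + n\<close>
  coordinates, as matrices acting from the left.\<close>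

definition incl1 :: "nat \<Rightarrow> nat \<Rightarrow> complex mat" where
  "incl1 m n = mat (m + n) m (\<lambda>(i,j). if i = j then 1 else 0)"

definition incl2 :: "nat \<Rightarrow> nat \<Rightarrow> complex mat" where
  "incl2 m n = mat (m + n) n (\<lambda>(i,j). if i = m + j then 1 else 0)"

lemma incl_carrier [simp]:
  "incl1 m n \<in> carrier_mat (m + n) m" "incl2 m n \<in> carrier_mat (m + n) n"
  by (auto simp: incl1_def incl2_def)

lemma if_mult_if:
  "(if P then 1 else 0) * (if P then 1 else 0) = (if P then 1 else (0 :: complex))"
  by simp

lemma incl1_isometry: "mat_adjoint (incl1 m n) * incl1 m n = 1\<^sub>m m"
  by (rule eq_matI) (auto simp: incl1_def scalar_prod_def if_distrib[of cnj] if_mult_if cong: if_cong)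

lemma incl2_isometry: "mat_adjoint (incl2 m n) * incl2 m n = 1\<^sub>m n"
  by (rule eq_matI) (auto simp: incl2_def scalar_prod_def if_distrib[of cnj] if_mult_if cong: if_cong)

text \<open>The permutation matrix that moves the first \<open>m\<close> of \<open>m + n\<close> coordinates behind the last \<open>n\<close>.\<close>

definition swap_mat :: "nat \<Rightarrow> nat \<Rightarrow> complex mat" where
  "swap_mat m n = four_block_mat (0\<^sub>m n m) (1\<^sub>m n) (1\<^sub>m m) (0\<^sub>m m n)"

lemma mat_adjoint_four_block:
  fixes A :: "complex mat"
  assumes "A \<in> carrier_mat a c" "B \<in> carrier_mat a d" "C \<in> carrier_mat b c" "D \<in> carrier_mat b d"
  shows "mat_adjoint (four_block_mat A B C D)
    = four_block_mat (mat_adjoint A) (mat_adjoint C) (mat_adjoint B) (mat_adjoint D)"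
  using assms by (intro eq_matI) auto

lemma swap_mat_isometry:
  "swap_mat m n \<in> carrier_mat (n + m) (m + n)"
  "mat_adjoint (swap_mat m n) * swap_mat m n = 1\<^sub>m (m + n)"
proof -
  show "swap_mat m n \<in> carrier_mat (n + m) (m + n)"
    unfolding swap_mat_def by (rule four_block_carrier_mat) auto
  have adj: "mat_adjoint (swap_mat m n) = four_block_mat (0\<^sub>m m n) (1\<^sub>m m) (1\<^sub>m n) (0\<^sub>m n m)"
    unfolding swap_mat_def
    by (simp add: mat_adjoint_four_block[of "0\<^sub>m n m" n m "1\<^sub>m n" n "1\<^sub>m m" m "0\<^sub>m m n"])
  show "mat_adjoint (swap_mat m n) * swap_mat m n = 1\<^sub>m (m + n)"
    unfolding adj unfolding swap_mat_def
    by (simp add: mult_four_block_mat[of "0\<^sub>m m n" m n "1\<^sub>m m" m "1\<^sub>m n" n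
          "0\<^sub>m n m" "0\<^sub>m n m" m "1\<^sub>m n" n "1\<^sub>m m" "0\<^sub>m m n"])
qed

text \<open>Halmos' dilation: an isometry \<open>A\<close> with \<open>m\<close> rows and \<open>n\<close> columns is a corner of a self-adjoint
  unitary \<open>U\<close> of size \<open>m + n\<close>.  The last property in the lemma below says that \<open>U\<close> takes the
  last \<open>n\<close> coordinates into the first \<open>m\<close> by \<open>A\<close>.\<close>

definition halmos :: "complex mat \<Rightarrow> complex mat" where
  "halmos A = four_block_mat (1\<^sub>m (dim_row A) - A * mat_adjoint A) A
     (mat_adjoint A) (0\<^sub>m (dim_col A) (dim_col A))"

lemma halmos:
  fixes A :: "complex mat"
  assumes A: "A \<in> carrier_mat m n" and iso: "mat_adjoint A * A = 1\<^sub>m n"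
  shows "halmos A \<in> carrier_mat (m + n) (m + n)" "mat_adjoint (halmos A) = halmos A"
    "halmos A * halmos A = 1\<^sub>m (m + n)" "halmos A * incl2 m n = incl1 m n * A"
proof -
  note D = defect_projection[OF A iso]
  have U: "halmos A = four_block_mat (1\<^sub>m m - A * mat_adjoint A) A (mat_adjoint A) (0\<^sub>m n n)"
    using A by (simp add: halmos_def)
  show C: "halmos A \<in> carrier_mat (m + n) (m + n)"
    unfolding U using D(1) by simp
  show "mat_adjoint (halmos A) = halmos A"
    unfolding U using A mat_adjoint_four_block[OF D(1) A, of "mat_adjoint A" n "0\<^sub>m n n"]
    by (simp add: D(2))
  show "halmos A * halmos A = 1\<^sub>m (m + n)"
    unfolding U using A D(1)
    by (subst mult_four_block_mat[of _ m m _ n _ n _ _ m _ n]) (auto simp: iso D(3,4,6))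
  show "halmos A * incl2 m n = incl1 m n * A"
  proof (rule eq_matI)
    fix i j assume "i < dim_row (incl1 m n * A)" "j < dim_col (incl1 m n * A)"
    then have i: "i < m + n" and j: "j < n" using A by (auto simp: incl1_def)
    have dims: "dim_row A = m" "dim_col A = n" using A by auto
    have "(halmos A * incl2 m n) $$ (i,j) = (\<Sum>k<m + n. if k = m + j then halmos A $$ (i,k) else 0)"
      using i j C by (auto simp: scalar_prod_def incl2_def atLeast0LessThan
          if_distrib[of "(*) _"] cong: if_cong)
    also have "\<dots> = halmos A $$ (i, m + j)" using j by simp
    also have "\<dots> = (if i < m then A $$ (i,j) else 0)"
      unfolding U using i j by (simp add: dims)
    also have "\<dots> = (\<Sum>k<m. if i = k then A $$ (k,j) else 0)" by simp
    also have "\<dots> = (incl1 m n * A) $$ (i,j)"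
      using i j A by (auto simp: scalar_prod_def incl1_def atLeast0LessThan
          if_distrib[of "\<lambda>x. x * _"] cong: if_cong)
    finally show "(halmos A * incl2 m n) $$ (i,j) = (incl1 m n * A) $$ (i,j)" .
  qed (use A C in \<open>auto simp: incl1_def incl2_def\<close>)
qed


section \<open>Matrices over a complex vector space with involution\<close>

lemma lmul_dim [simp]:
  "dim_row (lmul V A v) = dim_row A" "dim_col (lmul V A v) = dim_col v"
  by (auto simp: lmul_def)

lemma rmul_dim [simp]:
  "dim_row (rmul V v A) = dim_row v" "dim_col (rmul V v A) = dim_col A"
  by (auto simp: rmul_def)

lemma lmul_carrier [simp]:
  "A \<in> carrier_mat r m \<Longrightarrow> v \<in> carrier_mat m c \<Longrightarrow> lmul V A v \<in> carrier_mat r c"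
  by (auto simp: lmul_def)

lemma rmul_carrier [simp]:
  "v \<in> carrier_mat r m \<Longrightarrow> A \<in> carrier_mat m c \<Longrightarrow> rmul V v A \<in> carrier_mat r c"
  by (auto simp: rmul_def)

lemma lmul_index:
  "i < dim_row A \<Longrightarrow> j < dim_col v \<Longrightarrow>
    lmul V A v $$ (i,j) = (\<Sum>k<dim_col A. vscale V (A $$ (i,k)) (v $$ (k,j)))"
  by (simp add: lmul_def)

lemma rmul_index:
  "i < dim_row v \<Longrightarrow> j < dim_col A \<Longrightarrow>
    rmul V v A $$ (i,j) = (\<Sum>k<dim_row A. vscale V (A $$ (k,j)) (v $$ (i,k)))"
  by (simp add: rmul_def)

lemma mstar_dim [simp]:
  "dim_row (mstar V v) = dim_col v" "dim_col (mstar V v) = dim_row v"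
  by (auto simp: mstar_def)

lemma mstar_carrier [simp]: "v \<in> carrier_mat r c \<Longrightarrow> mstar V v \<in> carrier_mat c r"
  by (auto simp: mstar_def)

lemma mstar_index [simp]:
  "i < dim_col v \<Longrightarrow> j < dim_row v \<Longrightarrow> mstar V v $$ (i,j) = vstar V (v $$ (j,i))"
  by (simp add: mstar_def)

lemma rscale_dim [simp]:
  "dim_row (rscale V k v) = dim_row v" "dim_col (rscale V k v) = dim_col v"
  by (auto simp: rscale_def)

lemma rscale_carrier [simp]: "v \<in> carrier_mat r c \<Longrightarrow> rscale V k v \<in> carrier_mat r c"
  by (auto simp: rscale_def)

lemma rscale_index [simp]:
  "i < dim_row v \<Longrightarrow> j < dim_col v \<Longrightarrow>
    rscale V k v $$ (i,j) = vscale V (complex_of_real k) (v $$ (i,j))"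
  by (simp add: rscale_def)

lemma dsum_carrier [simp]:
  "v \<in> carrier_mat m n \<Longrightarrow> w \<in> carrier_mat r s \<Longrightarrow> dsum v w \<in> carrier_mat (m + r) (n + s)"
  by (auto simp: dsum_def)

lemma munit_carrier [simp]: "munit V n \<in> carrier_mat n n"
  by (auto simp: munit_def)

lemma munit_dim [simp]: "dim_row (munit V n) = n" "dim_col (munit V n) = n"
  by (auto simp: munit_def)

lemma MsaD: "v \<in> Msa V n \<Longrightarrow> v \<in> carrier_mat n n" "v \<in> Msa V n \<Longrightarrow> mstar V v = v"
  by (auto simp: Msa_def)

text \<open>The matrix \<open>A v A\<^sup>*\<close> for a scalar matrix \<open>A\<close>.  The adjoint stands on the right, whereas
  the compressions in the definition of a matrix ordered space have it on the left.\<close>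

definition conj_by :: "'v::comm_monoid_add matrix_space \<Rightarrow> complex mat \<Rightarrow> 'v mat \<Rightarrow> 'v mat" where
  "conj_by V A v = rmul V (lmul V A v) (mat_adjoint A)"

lemma conj_by_carrier [simp]:
  "A \<in> carrier_mat m n \<Longrightarrow> v \<in> carrier_mat n n \<Longrightarrow> conj_by V A v \<in> carrier_mat m m"
  unfolding conj_by_def by (metis lmul_carrier mat_adjoint_carrier rmul_carrier)

lemma mat_eq_diff_iff:
  fixes u v :: "'v::ab_group_add mat"
  assumes "u \<in> carrier_mat m n" "v \<in> carrier_mat m n"
  shows "u - v = 0\<^sub>m m n \<longleftrightarrow> u = v"
proof
  assume *: "u - v = 0\<^sub>m m n"
  show "u = v"
  proof (rule eq_matI)
    fix i j assume "i < dim_row v" "j < dim_col v"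
    then have "i < m" "j < n" using assms by auto
    then have "(u - v) $$ (i,j) = u $$ (i,j) - v $$ (i,j)" "(u - v) $$ (i,j) = 0"
      using assms index_minus_mat(1)[of i v j u] * by auto
    then show "u $$ (i,j) = v $$ (i,j)" by simp
  qed (use assms in auto)
qed (use assms in auto)

context star_vector_space
begin

sublocale vs: vector_space "vscale V"
  by (rule vector_space)

lemma vstar_zero [simp]: "vstar V 0 = 0"
  using star_add[of 0 0] by simp

lemma vstar_uminus: "vstar V (- x) = - vstar V x"
  using star_add[of x "- x"] by (simp add: eq_neg_iff_add_eq_0 add.commute)

lemma vstar_sum: "vstar V (\<Sum>i\<in>I. f i) = (\<Sum>i\<in>I. vstar V (f i))"
  by (induction I rule: infinite_finite_induct) (auto simp: star_add)

lemma mstar_mstar [simp]: "mstar V (mstar V v) = v"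
  by (rule eq_matI) (auto simp: star_star)

lemma mstar_zero [simp]: "mstar V (0\<^sub>m r c) = 0\<^sub>m c r"
  by (rule eq_matI) auto

lemma mstar_add: "u \<in> carrier_mat r c \<Longrightarrow> v \<in> carrier_mat r c \<Longrightarrow>
    mstar V (u + v) = mstar V u + mstar V v"
  by (rule eq_matI) (auto simp: star_add)

lemma mstar_minus: "u \<in> carrier_mat r c \<Longrightarrow> v \<in> carrier_mat r c \<Longrightarrow>
    mstar V (u - v) = mstar V u - mstar V v"
  by (rule eq_matI) (auto simp: star_add vstar_uminus diff_conv_add_uminus simp del: add_uminus_conv_diff)

lemma mstar_rscale: "mstar V (rscale V k v) = rscale V k (mstar V v)"
  by (rule eq_matI) (auto simp: star_scale)

lemma mstar_lmul:
  assumes "A \<in> carrier_mat r m" "v \<in> carrier_mat m c"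
  shows "mstar V (lmul V A v) = rmul V (mstar V v) (mat_adjoint A)"
  using assms by (intro eq_matI) (auto simp: lmul_index rmul_index vstar_sum star_scale)

lemma mstar_rmul:
  assumes "v \<in> carrier_mat r m" "A \<in> carrier_mat m c"
  shows "mstar V (rmul V v A) = lmul V (mat_adjoint A) (mstar V v)"
  using assms by (intro eq_matI) (auto simp: lmul_index rmul_index vstar_sum star_scale)

lemma lmul_lmul:
  assumes "A \<in> carrier_mat r m" "B \<in> carrier_mat m l" "v \<in> carrier_mat l c"
  shows "lmul V A (lmul V B v) = lmul V (A * B) v"
proof (rule eq_matI)
  fix i j assume "i < dim_row (lmul V (A * B) v)" "j < dim_col (lmul V (A * B) v)"
  then have ij: "i < r" "j < c" using assms by auto
  have "lmul V A (lmul V B v) $$ (i,j)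
      = (\<Sum>h<m. \<Sum>k<l. vscale V (A $$ (i,h) * B $$ (h,k)) (v $$ (k,j)))"
    using assms ij by (simp add: lmul_index vs.scale_sum_right)
  also have "\<dots> = (\<Sum>k<l. \<Sum>h<m. vscale V (A $$ (i,h) * B $$ (h,k)) (v $$ (k,j)))"
    by (rule sum.swap)
  also have "\<dots> = lmul V (A * B) v $$ (i,j)"
    using assms ij by (simp add: lmul_index vs.scale_sum_left scalar_prod_def atLeast0LessThan)
  finally show "lmul V A (lmul V B v) $$ (i,j) = lmul V (A * B) v $$ (i,j)" .
qed (use assms in auto)

lemma rmul_rmul:
  assumes "v \<in> carrier_mat r m" "A \<in> carrier_mat m l" "B \<in> carrier_mat l c"
  shows "rmul V (rmul V v A) B = rmul V v (A * B)"
proof (rule eq_matI)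
  fix i j assume "i < dim_row (rmul V v (A * B))" "j < dim_col (rmul V v (A * B))"
  then have ij: "i < r" "j < c" using assms by auto
  have "rmul V (rmul V v A) B $$ (i,j)
      = (\<Sum>k<l. \<Sum>h<m. vscale V (A $$ (h,k) * B $$ (k,j)) (v $$ (i,h)))"
    using assms ij by (simp add: rmul_index vs.scale_sum_right mult.commute)
  also have "\<dots> = (\<Sum>h<m. \<Sum>k<l. vscale V (A $$ (h,k) * B $$ (k,j)) (v $$ (i,h)))"
    by (rule sum.swap)
  also have "\<dots> = rmul V v (A * B) $$ (i,j)"
    using assms ij by (simp add: rmul_index vs.scale_sum_left scalar_prod_def atLeast0LessThan)
  finally show "rmul V (rmul V v A) B $$ (i,j) = rmul V v (A * B) $$ (i,j)" .
qed (use assms in auto)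

lemma rmul_lmul:
  assumes "A \<in> carrier_mat r m" "v \<in> carrier_mat m l" "B \<in> carrier_mat l c"
  shows "rmul V (lmul V A v) B = lmul V A (rmul V v B)"
proof (rule eq_matI)
  fix i j assume "i < dim_row (lmul V A (rmul V v B))" "j < dim_col (lmul V A (rmul V v B))"
  then have ij: "i < r" "j < c" using assms by auto
  have "rmul V (lmul V A v) B $$ (i,j)
      = (\<Sum>k<l. \<Sum>h<m. vscale V (A $$ (i,h) * B $$ (k,j)) (v $$ (h,k)))"
    using assms ij by (simp add: rmul_index lmul_index vs.scale_sum_right mult.commute)
  also have "\<dots> = (\<Sum>h<m. \<Sum>k<l. vscale V (A $$ (i,h) * B $$ (k,j)) (v $$ (h,k)))"
    by (rule sum.swap)
  also have "\<dots> = lmul V A (rmul V v B) $$ (i,j)"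
    using assms ij by (simp add: rmul_index lmul_index vs.scale_sum_right)
  finally show "rmul V (lmul V A v) B $$ (i,j) = lmul V A (rmul V v B) $$ (i,j)" .
qed (use assms in auto)

lemma vscale_if [simp]: "vscale V (if P then 1 else 0) x = (if P then x else 0)"
  by simp

lemma lmul_one [simp]: "v \<in> carrier_mat m c \<Longrightarrow> lmul V (1\<^sub>m m) v = v"
  by (rule eq_matI) (auto simp: lmul_index)

lemma rmul_one [simp]: "v \<in> carrier_mat r m \<Longrightarrow> rmul V v (1\<^sub>m m) = v"
  by (rule eq_matI) (auto simp: rmul_index)

lemma rmul_zero_left [simp]: "A \<in> carrier_mat m c \<Longrightarrow> rmul V (0\<^sub>m r m) A = 0\<^sub>m r c"
  by (rule eq_matI) (auto simp: rmul_index)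

lemma lmul_zero_left [simp]: "v \<in> carrier_mat m c \<Longrightarrow> lmul V (0\<^sub>m r m) v = 0\<^sub>m r c"
  by (rule eq_matI) (auto simp: lmul_index)

lemma lmul_minus:
  "A \<in> carrier_mat r m \<Longrightarrow> u \<in> carrier_mat m c \<Longrightarrow> v \<in> carrier_mat m c \<Longrightarrow>
    lmul V A (u - v) = lmul V A u - lmul V A v"
  by (rule eq_matI) (auto simp: lmul_index vs.scale_right_diff_distrib sum_subtractf)

lemma rmul_minus:
  "u \<in> carrier_mat r m \<Longrightarrow> v \<in> carrier_mat r m \<Longrightarrow> A \<in> carrier_mat m c \<Longrightarrow>
    rmul V (u - v) A = rmul V u A - rmul V v A"
  by (rule eq_matI) (auto simp: rmul_index vs.scale_right_diff_distrib sum_subtractf)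

lemma rmul_minus_right:
  "v \<in> carrier_mat r m \<Longrightarrow> A \<in> carrier_mat m c \<Longrightarrow> B \<in> carrier_mat m c \<Longrightarrow>
    rmul V v (A - B) = rmul V v A - rmul V v B"
  by (rule eq_matI) (auto simp: rmul_index vs.scale_left_diff_distrib sum_subtractf)

lemma lmul_add_left:
  "A \<in> carrier_mat r m \<Longrightarrow> B \<in> carrier_mat r m \<Longrightarrow> v \<in> carrier_mat m c \<Longrightarrow>
    lmul V (A + B) v = lmul V A v + lmul V B v"
  by (rule eq_matI) (auto simp: lmul_index vs.scale_left_distrib sum.distrib)

lemma rmul_add_right:
  "v \<in> carrier_mat r m \<Longrightarrow> A \<in> carrier_mat m c \<Longrightarrow> B \<in> carrier_mat m c \<Longrightarrow>
    rmul V v (A + B) = rmul V v A + rmul V v B"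
  by (rule eq_matI) (auto simp: rmul_index vs.scale_left_distrib sum.distrib)

lemma lmul_smult:
  "A \<in> carrier_mat r m \<Longrightarrow> v \<in> carrier_mat m c \<Longrightarrow>
    lmul V (z \<cdot>\<^sub>m A) v = map_mat (vscale V z) (lmul V A v)"
  by (rule eq_matI) (auto simp: lmul_index vs.scale_sum_right)

lemma rmul_smult:
  "v \<in> carrier_mat r m \<Longrightarrow> A \<in> carrier_mat m c \<Longrightarrow>
    rmul V v (z \<cdot>\<^sub>m A) = map_mat (vscale V z) (rmul V v A)"
  by (rule eq_matI) (auto simp: rmul_index vs.scale_sum_right)

lemma lmul_rscale:
  "A \<in> carrier_mat r m \<Longrightarrow> v \<in> carrier_mat m c \<Longrightarrow>
    lmul V A (rscale V k v) = rscale V k (lmul V A v)"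
  by (rule eq_matI) (auto simp: lmul_index vs.scale_sum_right mult.commute)

lemma rmul_rscale:
  "v \<in> carrier_mat r m \<Longrightarrow> A \<in> carrier_mat m c \<Longrightarrow>
    rmul V (rscale V k v) A = rscale V k (rmul V v A)"
  by (rule eq_matI) (auto simp: rmul_index vs.scale_sum_right mult.commute)

lemma rscale_rscale: "rscale V a (rscale V b v) = rscale V (a * b) v"
  by (rule eq_matI) auto

lemma rscale_one [simp]: "rscale V 1 v = v"
  by (rule eq_matI) auto

lemma rscale_zero [simp]: "v \<in> carrier_mat r c \<Longrightarrow> rscale V 0 v = 0\<^sub>m r c"
  by (rule eq_matI) auto

lemma rscale_minus:
  "u \<in> carrier_mat r c \<Longrightarrow> v \<in> carrier_mat r c \<Longrightarrow>
    rscale V k (u - v) = rscale V k u - rscale V k v"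
  by (rule eq_matI) (auto simp: vs.scale_right_diff_distrib)

lemma rscale_2: "rscale V 2 v = v + v"
  using vs.scale_left_distrib[of 1 1] by (intro eq_matI) auto

lemma rscale_minus_1: "rscale V (- 1) v = - v"
  by (rule eq_matI) auto

lemma munit_commute: "A \<in> carrier_mat m n \<Longrightarrow> lmul V A (munit V n) = rmul V (munit V m) A"
  by (rule eq_matI) (auto simp: lmul_index rmul_index munit_def if_distrib[of "vscale V _"] cong: if_cong)

lemma conj_by_conj_by:
  assumes A: "A \<in> carrier_mat r m" and B: "B \<in> carrier_mat m n" and v: "v \<in> carrier_mat n n"
  shows "conj_by V A (conj_by V B v) = conj_by V (A * B) v"
proof -
  have B': "mat_adjoint B \<in> carrier_mat n m" and A': "mat_adjoint A \<in> carrier_mat m r"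
    using A B by auto
  have Bv: "lmul V B v \<in> carrier_mat m n" using B v by simp
  show ?thesis
    unfolding conj_by_def mat_adjoint_mult[OF A B]
      rmul_lmul[OF A Bv B', symmetric] lmul_lmul[OF A B v]
    by (rule rmul_rmul[OF _ B' A']) (use A B v in auto)
qed

lemma conj_by_one [simp]: "v \<in> carrier_mat n n \<Longrightarrow> conj_by V (1\<^sub>m n) v = v"
  by (simp add: conj_by_def)

lemma conj_by_minus:
  assumes "A \<in> carrier_mat m n" "u \<in> carrier_mat n n" "v \<in> carrier_mat n n"
  shows "conj_by V A (u - v) = conj_by V A u - conj_by V A v"
  using assms by (simp add: conj_by_def lmul_minus rmul_minus[of _ m n _ _ m])

lemma conj_by_rscale:
  assumes "A \<in> carrier_mat m n" "v \<in> carrier_mat n n"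
  shows "conj_by V A (rscale V k v) = rscale V k (conj_by V A v)"
  using assms by (simp add: conj_by_def lmul_rscale rmul_rscale[of _ m n _ m])

lemma mstar_conj_by:
  assumes "A \<in> carrier_mat m n" "v \<in> carrier_mat n n"
  shows "mstar V (conj_by V A v) = conj_by V A (mstar V v)"
  using assms by (simp add: conj_by_def mstar_rmul[of _ n n _ m] mstar_lmul[of _ m n _ m] rmul_lmul[of _ m n _ n _ m])

lemma conj_by_isometry_cancel:
  assumes A: "A \<in> carrier_mat m n" and iso: "mat_adjoint A * A = 1\<^sub>m n" and v: "v \<in> carrier_mat n n"
  shows "conj_by V (mat_adjoint A) (conj_by V A v) = v"
  using conj_by_conj_by[OF _ A v, of "mat_adjoint A" n] A v by (simp add: iso)

lemma conj_by_unitary_munit: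
  assumes "U \<in> carrier_mat n n" "U * mat_adjoint U = 1\<^sub>m n"
  shows "conj_by V U (munit V n) = munit V n"
  using assms by (simp add: conj_by_def munit_commute rmul_rmul[of _ n n _ n _ n] rmul_one[of _ n])

text \<open>Summing with a zero matrix is conjugation by an inclusion, hence by an isometry.\<close>

lemma lmul_incl1_rmul:
  assumes "v \<in> carrier_mat m r"
  shows "rmul V (lmul V (incl1 m n) v) (mat_adjoint (incl1 r s)) = dsum v (0\<^sub>m n s)"
  using assms
  by (intro eq_matI) (auto simp: lmul_index rmul_index incl1_def dsum_def if_distrib[of cnj]
      vs.scale_sum_right if_distrib[of "vscale V _"] cong: if_cong)

lemma lmul_incl2_rmul:
  assumes "v \<in> carrier_mat n s"
  shows "rmul V (lmul V (incl2 m n) v) (mat_adjoint (incl2 r s)) = dsum (0\<^sub>m m r) v"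
proof (rule eq_matI)
  fix i j assume "i < dim_row (dsum (0\<^sub>m m r) v)" "j < dim_col (dsum (0\<^sub>m m r) v)"
  then have ij: "i < m + n" "j < r + s" using assms by (auto simp: dsum_def)
  have L: "lmul V (incl2 m n) v $$ (i,h) = (if i < m then 0 else v $$ (i - m, h))" if "h < s" for h
  proof -
    have "(\<Sum>k<n. if i = m + k then v $$ (k,h) else 0)
        = (\<Sum>k<n. if k = i - m then (if i < m then 0 else v $$ (i - m,h)) else 0)"
      by (intro sum.cong) auto
    then show ?thesis using assms ij that by (auto simp: lmul_index incl2_def)
  qed
  have "rmul V (lmul V (incl2 m n) v) (mat_adjoint (incl2 r s)) $$ (i,j)
      = (\<Sum>k<s. if j = r + k then lmul V (incl2 m n) v $$ (i,k) else 0)"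
    using assms ij by (auto simp: rmul_index incl2_def if_distrib[of cnj] cong: if_cong)
  also have "\<dots> = (\<Sum>k<s. if k = j - r then
      (if j < r then 0 else lmul V (incl2 m n) v $$ (i,j - r)) else 0)"
    by (intro sum.cong) auto
  also have "\<dots> = dsum (0\<^sub>m m r) v $$ (i,j)"
    using assms ij L[of "j - r"] by (auto simp: dsum_def)
  finally show "rmul V (lmul V (incl2 m n) v) (mat_adjoint (incl2 r s)) $$ (i,j)
      = dsum (0\<^sub>m m r) v $$ (i,j)" .
qed (use assms in \<open>auto simp: dsum_def incl2_def\<close>)

lemma conj_by_incl1: "v \<in> carrier_mat m m \<Longrightarrow> conj_by V (incl1 m n) v = dsum v (0\<^sub>m n n)"
  by (simp add: conj_by_def lmul_incl1_rmul)

lemma conj_by_incl2: "v \<in> carrier_mat n n \<Longrightarrow> conj_by V (incl2 m n) v = dsum (0\<^sub>m m m) v"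
  by (simp add: conj_by_def lmul_incl2_rmul)

text \<open>Interchanging the block rows turns the self-adjoint dilation of \<open>v\<close> into \<open>v\<^sup>* \<oplus> v\<close>.\<close>

lemma lmul_swap_dilation:
  assumes v: "v \<in> carrier_mat m n"
  shows "lmul V (swap_mat m n) (sa_dilation V v) = dsum (mstar V v) v"
proof (rule eq_matI)
  fix i j assume "i < dim_row (dsum (mstar V v) v)" "j < dim_col (dsum (mstar V v) v)"
  then have ij: "i < n + m" "j < m + n" using v by (auto simp: dsum_def)
  have S: "swap_mat m n $$ (i,k) = (if k = (if i < n then m + i else i - n) then 1 else 0)"
    if "k < m + n" for k
    using ij that by (auto simp: swap_mat_def)
  have "lmul V (swap_mat m n) (sa_dilation V v) $$ (i,j)
      = (\<Sum>k<m + n. if k = (if i < n then m + i else i - n) then sa_dilation V v $$ (k,j) else 0)"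
    using v ij swap_mat_isometry(1)[of m n]
    by (auto simp: lmul_index sa_dilation_def S simp del: index_mat_four_block(1))
  also have "\<dots> = sa_dilation V v $$ (if i < n then m + i else i - n, j)"
    using ij by auto
  also have "\<dots> = dsum (mstar V v) v $$ (i,j)"
    using v ij by (auto simp: sa_dilation_def dsum_def)
  finally show "lmul V (swap_mat m n) (sa_dilation V v) $$ (i,j) = dsum (mstar V v) v $$ (i,j)" .
qed (use v swap_mat_isometry(1)[of m n] in \<open>auto simp: sa_dilation_def dsum_def\<close>)

lemma sa_dilation_carrier [simp]:
  "v \<in> carrier_mat m n \<Longrightarrow> sa_dilation V v \<in> carrier_mat (m + n) (m + n)"
  unfolding sa_dilation_def by (rule four_block_carrier_mat) auto

lemma sa_dilation_Msa:
  "v \<in> carrier_mat m n \<Longrightarrow> sa_dilation V v \<in> Msa V (m + n)"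
  unfolding Msa_def by (auto intro!: eq_matI simp: sa_dilation_def star_star)

lemma sa_dilation_add:
  "u \<in> carrier_mat m n \<Longrightarrow> v \<in> carrier_mat m n \<Longrightarrow>
    sa_dilation V (u + v) = sa_dilation V u + sa_dilation V v"
  by (rule eq_matI) (auto simp: sa_dilation_def star_add)

lemma munit_dsum: "dsum (munit V m) (munit V n) = munit V (m + n)"
  by (rule eq_matI) (auto simp: dsum_def munit_def)

lemma mstar_dsum:
  "v \<in> carrier_mat m n \<Longrightarrow> w \<in> carrier_mat r s \<Longrightarrow> mstar V (dsum v w) = dsum (mstar V v) (mstar V w)"
  by (rule eq_matI) (auto simp: dsum_def)

end

lemma dsum_add:
  fixes u v w x :: "'v::ab_group_add mat"
  assumes "u \<in> carrier_mat m n" "v \<in> carrier_mat m n" "w \<in> carrier_mat r s" "x \<in> carrier_mat r s"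
  shows "dsum u w + dsum v x = dsum (u + v) (w + x)"
  using assms by (intro eq_matI) (auto simp: dsum_def)

lemma dsum_minus:
  fixes u v w x :: "'v::ab_group_add mat"
  assumes "u \<in> carrier_mat m n" "v \<in> carrier_mat m n" "w \<in> carrier_mat r s" "x \<in> carrier_mat r s"
  shows "dsum u w - dsum v x = dsum (u - v) (w - x)"
  using assms by (intro eq_matI) (auto simp: dsum_def)

lemma dsum_inject:
  fixes v v' w w' :: "'v::zero mat"
  assumes v: "v \<in> carrier_mat m n" "v' \<in> carrier_mat m n" and w: "w \<in> carrier_mat r s" "w' \<in> carrier_mat r s"
    and eq: "dsum v w = dsum v' w'"
  shows "v = v'" "w = w'"
proof -
  show "v = v'"
  proof (rule eq_matI)
    fix i j assume "i < dim_row v'" "j < dim_col v'"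
    then have "dsum v w $$ (i,j) = v $$ (i,j)" "dsum v' w' $$ (i,j) = v' $$ (i,j)"
      using v w by (auto simp: dsum_def)
    then show "v $$ (i,j) = v' $$ (i,j)" by (simp add: eq)
  qed (use v in auto)
  show "w = w'"
  proof (rule eq_matI)
    fix i j assume "i < dim_row w'" "j < dim_col w'"
    then have "dsum v w $$ (m + i,n + j) = w $$ (i,j)" "dsum v' w' $$ (m + i,n + j) = w' $$ (i,j)"
      using v w by (auto simp: dsum_def)
    then show "w $$ (i,j) = w' $$ (i,j)" by (simp add: eq)
  qed (use w in auto)
qed



section \<open>Positive matrices\<close>

context star_vector_space
begin

lemma rmul_add:
  "u \<in> carrier_mat r m \<Longrightarrow> v \<in> carrier_mat r m \<Longrightarrow> A \<in> carrier_mat m c \<Longrightarrow>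
    rmul V (u + v) A = rmul V u A + rmul V v A"
  by (rule eq_matI) (auto simp: rmul_index vs.scale_right_distrib sum.distrib)

lemma rmul_map_vscale:
  "v \<in> carrier_mat r m \<Longrightarrow> A \<in> carrier_mat m c \<Longrightarrow>
    rmul V (map_mat (vscale V z) v) A = map_mat (vscale V z) (rmul V v A)"
  by (rule eq_matI) (auto simp: rmul_index vs.scale_sum_right mult.commute)

lemma Msa_minus: "u \<in> Msa V n \<Longrightarrow> v \<in> Msa V n \<Longrightarrow> u - v \<in> Msa V n"
  by (auto simp: Msa_def mstar_minus)

lemma Msa_add: "u \<in> Msa V n \<Longrightarrow> v \<in> Msa V n \<Longrightarrow> u + v \<in> Msa V n"
  by (auto simp: Msa_def mstar_add)

lemma Msa_rscale: "u \<in> Msa V n \<Longrightarrow> rscale V k u \<in> Msa V n"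
  by (auto simp: Msa_def mstar_rscale)

lemma lmul_incl2_adjoint_index:
  assumes "X \<in> carrier_mat (m + n) c" "i < n" "j < c"
  shows "lmul V (mat_adjoint (incl2 m n)) X $$ (i,j) = X $$ (m + i,j)"
  using assms by (auto simp: lmul_index incl2_def if_distrib[of cnj] cong: if_cong)

lemma rmul_incl2_index:
  assumes "X \<in> carrier_mat r (m + n)" "i < r" "j < n"
  shows "rmul V X (incl2 m n) $$ (i,j) = X $$ (i,m + j)"
  using assms by (auto simp: rmul_index incl2_def)

text \<open>Row \<open>i\<close> of \<open>X\<close> occurs in \<open>G\<^sup>* X\<close> for the \<open>G\<close> all of whose columns are the \<open>i\<close>-th coordinate
  vector.\<close>

lemma eq_zero_if_lmul_zero:
  assumes X: "X \<in> carrier_mat r c" and c: "0 < c"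
    and 0: "\<And>G. G \<in> carrier_mat r c \<Longrightarrow> lmul V (mat_adjoint G) X = 0\<^sub>m c c"
  shows "X = 0\<^sub>m r c"
proof (rule eq_matI)
  fix i j assume ij': "i < dim_row (0\<^sub>m r c :: 'v mat)" "j < dim_col (0\<^sub>m r c :: 'v mat)"
  then have ij: "i < r" "j < c" by auto
  define G where "G = mat r c (\<lambda>(a,b). if a = i then (1 :: complex) else 0)"
  have G: "G \<in> carrier_mat r c" by (auto simp: G_def)
  have "X $$ (i,j) = lmul V (mat_adjoint G) X $$ (0,j)"
    using X G ij c by (simp add: lmul_index) (simp add: G_def if_distrib[of cnj] cong: if_cong)
  also have "\<dots> = 0" using 0[OF G] ij c by simp
  finally show "X $$ (i,j) = 0\<^sub>m r c $$ (i,j)" using ij by simp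
qed (use X in auto)

end

context matrix_ordered_space
begin

lemma cone_Msa: "0 < n \<Longrightarrow> v \<in> mcone V n \<Longrightarrow> v \<in> Msa V n"
  using ordered[of n] by (auto simp: real_ordered_space_def)

lemma cone_carrier: "0 < n \<Longrightarrow> v \<in> mcone V n \<Longrightarrow> v \<in> carrier_mat n n"
  using cone_Msa MsaD(1) by blast

lemma cone_add: "0 < n \<Longrightarrow> u \<in> mcone V n \<Longrightarrow> v \<in> mcone V n \<Longrightarrow> u + v \<in> mcone V n"
  using ordered[of n] by (auto simp: real_ordered_space_def)

lemma cone_rscale: "0 < n \<Longrightarrow> 0 \<le> k \<Longrightarrow> v \<in> mcone V n \<Longrightarrow> rscale V k v \<in> mcone V n"
  using ordered[of n] by (auto simp: real_ordered_space_def)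

lemma cone_zero: assumes "0 < n" shows "0\<^sub>m n n \<in> mcone V n"
proof -
  obtain v where v: "v \<in> mcone V n"
    using ordered[OF assms] by (auto simp: real_ordered_space_def)
  then show ?thesis
    using cone_rscale[OF assms order_refl v] cone_carrier[OF assms v] by simp
qed

lemma cone_conj_by:
  assumes "0 < m" "0 < n" "A \<in> carrier_mat m n" "v \<in> mcone V n"
  shows "conj_by V A v \<in> mcone V m"
  using compress[of m n v "mat_adjoint A"] assms by (simp add: conj_by_def)

lemma mle_refl: "0 < n \<Longrightarrow> u \<in> Msa V n \<Longrightarrow> mle V n u u"
  using cone_zero[of n] MsaD(1)[of u V n] by (simp add: mle_def)

lemma mle_trans:
  assumes "0 < n" "mle V n u v" "mle V n v w"
  shows "mle V n u w"
proof -
  have c: "u \<in> carrier_mat n n" "v \<in> carrier_mat n n" "w \<in> carrier_mat n n"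
    using assms MsaD(1) by (auto simp: mle_def)
  have "(w - v) + (v - u) \<in> mcone V n"
    using assms by (intro cone_add) (auto simp: mle_def)
  also have "(w - v) + (v - u) = w - u"
    using c by (intro eq_matI) auto
  finally show ?thesis using assms by (auto simp: mle_def)
qed

lemma mle_conj_by:
  assumes "0 < m" "0 < n" and A: "A \<in> carrier_mat m n" and le: "mle V n u v"
  shows "mle V m (conj_by V A u) (conj_by V A v)"
proof -
  have sa: "u \<in> Msa V n" "v \<in> Msa V n" and c: "v - u \<in> mcone V n"
    using le by (auto simp: mle_def)
  note uv = sa[THEN MsaD(1)]
  have "conj_by V A (v - u) \<in> mcone V m" using cone_conj_by assms c by blast
  then show ?thesis
    using A uv sa[THEN MsaD(2)]
    by (simp add: mle_def Msa_def mstar_conj_by[OF A] conj_by_minus[OF A])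
qed

end

context matrix_order_unit_space
begin

lemma mat1_index: "M \<in> carrier_mat 1 1 \<Longrightarrow> mat1 (M $$ (0,0)) = M"
  by (rule eq_matI) (auto simp: mat1_def)

lemma cone_1_proper:
  assumes "x \<in> mcone V 1" "- x \<in> mcone V 1"
  shows "x = 0\<^sub>m 1 1"
proof -
  have x: "x \<in> carrier_mat 1 1" using assms(1) cone_carrier by auto
  have "mat1 (x $$ (0,0)) = x" "mat1 (- (x $$ (0,0))) = - x"
    using x mat1_index[OF x] mat1_index[of "- x"] by auto
  then have "x $$ (0,0) \<in> Vpos V" "- (x $$ (0,0)) \<in> Vpos V"
    using assms by (auto simp: Vpos_def)
  then have "x $$ (0,0) \<in> Vpos V \<inter> uminus ` Vpos V"
    by (auto intro: image_eqI[of _ _ "- (x $$ (0,0))"])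
  then have "x $$ (0,0) = 0" using proper by auto
  then show ?thesis using x by (intro eq_matI) auto
qed

text \<open>A positive matrix \<open>M\<close> with \<open>B\<^sup>* M B = 0\<close> satisfies \<open>M B = 0\<close>.  As \<open>(G + z B)\<^sup>* M (G + z B)\<close>
  is positive for every scalar \<open>z\<close> and has no term quadratic in \<open>z\<close>, the Archimedean property makes
  \<open>z G\<^sup>* M B + cnj z B\<^sup>* M G\<close> positive for every \<open>z\<close>, hence zero.  Only properness of the cone
  of size \<open>m\<close> enters; the case \<open>m = 1\<close> then yields properness for all sizes.\<close>

lemma cone_null_proper:
  assumes m: "0 < m" and N: "0 < N"
    and proper_m: "\<And>x. x \<in> mcone V m \<Longrightarrow> - x \<in> mcone V m \<Longrightarrow> x = 0\<^sub>m m m"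
    and M: "M \<in> mcone V N" and B: "B \<in> carrier_mat N m"
    and null: "conj_by V (mat_adjoint B) M = 0\<^sub>m m m"
  shows "rmul V M B = 0\<^sub>m N m"
proof (rule eq_zero_if_lmul_zero)
  have Mc: "M \<in> carrier_mat N N" using M N cone_carrier by blast
  show MB: "rmul V M B \<in> carrier_mat N m" using Mc B by simp
  fix G :: "complex mat" assume G: "G \<in> carrier_mat N m"
  define a b where "a = lmul V (mat_adjoint G) M" and "b = lmul V (mat_adjoint B) M"
  have a: "a \<in> carrier_mat m N" and b: "b \<in> carrier_mat m N"
    using Mc G B by (auto simp: a_def b_def)
  define P X Y where "P = rmul V a G" and "X = rmul V a B" and "Y = rmul V b G"
  have bB: "rmul V b B = 0\<^sub>m m m" using null by (simp add: conj_by_def b_def)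
  have c: "P \<in> carrier_mat m m" "X \<in> carrier_mat m m" "Y \<in> carrier_mat m m"
    using a b G B by (auto simp: P_def X_def Y_def)
  define K where "K z = map_mat (vscale V z) X + map_mat (vscale V (cnj z)) Y" for z
  have K: "K z \<in> carrier_mat m m" for z using c by (auto simp: K_def)
  have pos: "P + K z \<in> mcone V m" for z
  proof -
    let ?H = "G + z \<cdot>\<^sub>m B"
    have zB: "z \<cdot>\<^sub>m B \<in> carrier_mat N m" and H: "?H \<in> carrier_mat N m" using G B by auto
    have adj: "mat_adjoint ?H = mat_adjoint G + cnj z \<cdot>\<^sub>m mat_adjoint B"
      using G B by (intro eq_matI) auto
    let ?b = "map_mat (vscale V (cnj z)) b"
    have b': "?b \<in> carrier_mat m N" using b by simp
    have "lmul V (mat_adjoint ?H) M = a + ?b"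
      unfolding adj using G B Mc
      by (simp add: lmul_add_left[of _ m N _ _ N] lmul_smult[of _ m N _ N] a_def b_def)
    then have "conj_by V (mat_adjoint ?H) M = rmul V (a + ?b) ?H"
      by (simp add: conj_by_def)
    also have "\<dots> = (rmul V a G + rmul V a (z \<cdot>\<^sub>m B)) + (rmul V ?b G + rmul V ?b (z \<cdot>\<^sub>m B))"
      by (simp only: rmul_add[OF a b' H] rmul_add_right[OF a G zB] rmul_add_right[OF b' G zB])
    also have "\<dots> = P + K z"
      unfolding rmul_smult[OF a B] rmul_smult[OF b' B] rmul_map_vscale[OF b G] rmul_map_vscale[OF b B]
        bB P_def[symmetric] X_def[symmetric] Y_def[symmetric] K_def
      using c by (intro eq_matI) (auto simp: add.assoc)
    finally have "P + K z = conj_by V (mat_adjoint ?H) M" by simp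
    also have "\<dots> \<in> mcone V m" using H M m N by (intro cone_conj_by[of m N]) auto
    finally show ?thesis .
  qed
  have "P = conj_by V (mat_adjoint G) M" by (simp add: P_def a_def conj_by_def)
  also have "\<dots> \<in> mcone V m" using G M m N by (intro cone_conj_by[of m N]) auto
  finally have Ppos: "P \<in> mcone V m" .
  \<comment> \<open>Since \<open>K\<close> is homogeneous for positive factors, \<open>K z + k P = k (P + K (z / k))\<close>.\<close>
  have Kpos: "K z \<in> mcone V m" for z
  proof (rule archimedean[OF m])
    show Psa: "P \<in> Msa V m" using cone_Msa m Ppos by blast
    have "(P + K z) - P \<in> Msa V m" using Msa_minus cone_Msa[OF m pos] Psa by blast
    also have "(P + K z) - P = K z" using c(1) K[of z] by (intro eq_matI) auto
    finally show "K z \<in> Msa V m" .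
    fix k :: real assume k: "k > 0"
    have "rscale V k (P + K (complex_of_real (1 / k) * z)) \<in> mcone V m"
      using k by (intro cone_rscale m pos) auto
    also have "rscale V k (P + K (complex_of_real (1 / k) * z)) = K z + rscale V k P"
      using c k by (intro eq_matI) (auto simp: K_def vs.scale_right_distrib)
    finally show "K z + rscale V k P \<in> mcone V m" .
  qed
  have K0: "K z = 0\<^sub>m m m" for z
  proof (rule proper_m[OF Kpos])
    have "- K z = K (- z)" using c by (intro eq_matI) (auto simp: K_def)
    then show "- K z \<in> mcone V m" using Kpos by simp
  qed
  \<comment> \<open>\<open>K 1 = X + Y\<close> and \<open>K \<i> = \<i> (X - Y)\<close>.\<close>
  have "X = 0\<^sub>m m m"
  proof (rule eq_matI)
    fix i j assume "i < dim_row (0\<^sub>m m m :: 'v mat)" "j < dim_col (0\<^sub>m m m :: 'v mat)"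
    then have ij: "i < m" "j < m" by auto
    define x y where "x = X $$ (i,j)" and "y = Y $$ (i,j)"
    have "K 1 $$ (i,j) = 0" "K \<i> $$ (i,j) = 0" using K0 ij by auto
    then have 1: "x + y = 0" and "vscale V \<i> x + vscale V (- \<i>) y = 0"
      using c ij by (auto simp: K_def x_def y_def)
    then have "vscale V \<i> (x - y) = 0" by (simp add: vs.scale_right_diff_distrib)
    then have "x = y" by simp
    with 1 have "vscale V 2 x = 0" using vs.scale_left_distrib[of 1 1 x] by simp
    then show "X $$ (i,j) = 0\<^sub>m m m $$ (i,j)" using ij by (simp add: x_def)
  qed (use c in auto)
  then show "lmul V (mat_adjoint G) (rmul V M B) = 0\<^sub>m m m"
    using rmul_lmul[of "mat_adjoint G" m N M N B m] G B Mc by (simp add: X_def a_def)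
qed (rule m)

lemma cone_proper:
  assumes n: "0 < n" and x: "x \<in> mcone V n" "- x \<in> mcone V n"
  shows "x = 0\<^sub>m n n"
proof (rule eq_matI)
  have xc: "x \<in> carrier_mat n n" using n x cone_carrier by blast
  fix i j assume "i < dim_row (0\<^sub>m n n :: 'v mat)" "j < dim_col (0\<^sub>m n n :: 'v mat)"
  then have ij: "i < n" "j < n" by auto
  define B where "B = mat n 1 (\<lambda>(a,b). if a = j then (1 :: complex) else 0)"
  have B: "B \<in> carrier_mat n 1" and B': "mat_adjoint B \<in> carrier_mat 1 n"
    by (auto simp: B_def)
  have "- conj_by V (mat_adjoint B) x = conj_by V (mat_adjoint B) (- x)"
    using conj_by_rscale[OF B' xc, of "- 1"] by (simp add: rscale_minus_1)
  then have "conj_by V (mat_adjoint B) x = 0\<^sub>m 1 1"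
    using cone_conj_by[OF _ n B'] x by (intro cone_1_proper) auto
  then have "rmul V x B = 0\<^sub>m n 1"
    using cone_null_proper[OF _ n cone_1_proper x(1) B] by simp
  moreover have "rmul V x B $$ (i,0) = x $$ (i,j)"
    using xc ij by (auto simp: rmul_index B_def)
  ultimately show "x $$ (i,j) = 0\<^sub>m n n $$ (i,j)" using ij by simp
qed (use cone_carrier[OF n x(1)] in auto)

lemma cone_null:
  assumes "0 < m" "0 < N" "M \<in> mcone V N" "B \<in> carrier_mat N m"
    and "conj_by V (mat_adjoint B) M = 0\<^sub>m m m"
  shows "rmul V M B = 0\<^sub>m N m"
  using cone_null_proper[OF assms(1,2) cone_proper[OF assms(1)]] assms by blast

lemma mle_antisym:
  assumes "0 < n" "mle V n u v" "mle V n v u"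
  shows "u = v"
proof -
  have c: "u \<in> carrier_mat n n" "v \<in> carrier_mat n n"
    using assms MsaD(1) by (auto simp: mle_def)
  have "- (u - v) = v - u" using c by (intro eq_matI) auto
  then have "u - v = 0\<^sub>m n n" using assms by (intro cone_proper) (auto simp: mle_def)
  then show ?thesis using mat_eq_diff_iff[OF c] by simp
qed

end


section \<open>The absolute value\<close>

context absolutely_matrix_ordered_space
begin

lemma mabs_Msa: "0 < m \<Longrightarrow> 0 < n \<Longrightarrow> v \<in> carrier_mat m n \<Longrightarrow> mabs V v \<in> Msa V n"
  using mabs_cone cone_Msa by blast

lemma mabs_carrier [simp]:
  "0 < m \<Longrightarrow> 0 < n \<Longrightarrow> v \<in> carrier_mat m n \<Longrightarrow> mabs V v \<in> carrier_mat n n"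
  using mabs_Msa MsaD(1) by blast

lemma mabs_of_cone: "0 < n \<Longrightarrow> v \<in> mcone V n \<Longrightarrow> mabs V v = v"
  using absolutely_ordered[of n] by (auto simp: absolutely_ordered_space_def)

lemma mabs_ge:
  assumes "0 < n" "v \<in> Msa V n"
  shows "mabs V v + v \<in> mcone V n" "mabs V v - v \<in> mcone V n"
  using absolutely_ordered[of n] assms by (auto simp: absolutely_ordered_space_def)

lemma mabs_rscale: "0 < n \<Longrightarrow> v \<in> Msa V n \<Longrightarrow> mabs V (rscale V k v) = rscale V \<bar>k\<bar> (mabs V v)"
  using absolutely_ordered[of n] by (auto simp: absolutely_ordered_space_def)

lemma orthogonal_mono:
  assumes "0 < n" "u \<in> Msa V n" "v \<in> Msa V n" "mabs V (u - v) = u + v"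
    and "w \<in> mcone V n" "v - w \<in> mcone V n"
  shows "mabs V (u - w) = u + w"
proof -
  have "w \<in> Msa V n" using cone_Msa assms by blast
  then show ?thesis
    using absolutely_ordered[of n] assms unfolding absolutely_ordered_space_def by blast
qed

lemma orthogonal_add:
  assumes "0 < n" "u \<in> Msa V n" "v \<in> mcone V n" "w \<in> mcone V n"
    and "mabs V (u - v) = u + v" "mabs V (u - w) = u + w"
  shows "mabs V (u - (v + w)) = u + (v + w)"
proof -
  have "v \<in> Msa V n" "w \<in> Msa V n" using cone_Msa assms by auto
  then have "mabs V (u - mabs V (v + w)) = u + mabs V (v + w)"
    using absolutely_ordered[of n] assms unfolding absolutely_ordered_space_def by blast
  moreover have "mabs V (v + w) = v + w" using assms by (intro mabs_of_cone cone_add)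
  ultimately show ?thesis by simp
qed

lemma mabs_uminus: "0 < n \<Longrightarrow> v \<in> Msa V n \<Longrightarrow> mabs V (- v) = mabs V v"
  using mabs_rscale[of n v "- 1"] by (simp add: rscale_minus_1)

lemma orthogonal_sym:
  assumes "0 < n" "u \<in> Msa V n" "v \<in> Msa V n" "mabs V (u - v) = u + v"
  shows "mabs V (v - u) = v + u"
proof -
  have c: "u \<in> carrier_mat n n" "v \<in> carrier_mat n n" using assms MsaD by auto
  have "v - u = - (u - v)" using c by (intro eq_matI) auto
  then have "mabs V (v - u) = u + v"
    using mabs_uminus[OF \<open>0 < n\<close> Msa_minus] assms by simp
  then show ?thesis using comm_add_mat[OF c] by simp
qed

lemma rscale_2_inject:
  assumes "u \<in> carrier_mat m n" "v \<in> carrier_mat m n" "rscale V 2 u = rscale V 2 v"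
  shows "u = v"
proof -
  have "rscale V (1/2) (rscale V 2 u) = rscale V (1/2) (rscale V 2 v)" using assms by simp
  then show ?thesis by (simp add: rscale_rscale)
qed

text \<open>The absolute value is additive on orthogonal self-adjoint elements: with \<open>a\<close>, \<open>b\<close> twice the
  positive and negative parts of \<open>x\<close>, and \<open>c\<close>, \<open>d\<close> those of \<open>y\<close>, both \<open>a\<close> and \<open>c\<close> are orthogonal to
  both \<open>b\<close> and \<open>d\<close>, so \<open>a + c\<close> is orthogonal to \<open>b + d\<close>.\<close>

lemma mabs_add_orthogonal:
  assumes n: "0 < n" and x: "x \<in> Msa V n" and y: "y \<in> Msa V n"
    and orth: "mabs V (mabs V x - mabs V y) = mabs V x + mabs V y"
  shows "mabs V (x + y) = mabs V x + mabs V y"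
proof -
  define X Y where "X = mabs V x" and "Y = mabs V y"
  define a b c d where "a = X + x" and "b = X - x" and "c = Y + y" and "d = Y - y"
  have xy: "x \<in> carrier_mat n n" "y \<in> carrier_mat n n" using x y MsaD by auto
  have XYc: "X \<in> carrier_mat n n" "Y \<in> carrier_mat n n"
    using mabs_carrier n xy by (auto simp: X_def Y_def)
  have XY: "X \<in> Msa V n" "Y \<in> Msa V n" using n xy by (auto simp: X_def Y_def intro: mabs_Msa)
  have pos: "a \<in> mcone V n" "b \<in> mcone V n" "c \<in> mcone V n" "d \<in> mcone V n"
    using mabs_ge[OF n x] mabs_ge[OF n y] by (auto simp: a_def b_def c_def d_def X_def Y_def)
  note sa = pos[THEN cone_Msa[OF n]]
  have cc: "a \<in> carrier_mat n n" "b \<in> carrier_mat n n" "c \<in> carrier_mat n n" "d \<in> carrier_mat n n"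
    using sa MsaD by auto
  have "mabs V (rscale V 2 X - rscale V 2 Y) = rscale V 2 X + rscale V 2 Y"
  proof -
    have "rscale V 2 X - rscale V 2 Y = rscale V 2 (X - Y)"
      using XYc by (simp add: rscale_minus)
    then have "mabs V (rscale V 2 X - rscale V 2 Y) = rscale V 2 (X + Y)"
      using mabs_rscale[OF n Msa_minus[OF XY], of 2] orth by (simp add: X_def Y_def)
    also have "\<dots> = rscale V 2 X + rscale V 2 Y"
      using XYc by (intro eq_matI) (auto simp: vs.scale_right_distrib)
    finally show ?thesis .
  qed
  moreover have X2: "rscale V 2 X = a + b" and Y2: "rscale V 2 Y = c + d"
    using XYc xy unfolding rscale_2 a_def b_def c_def d_def by (auto intro!: eq_matI)
  ultimately have o: "mabs V ((a + b) - (c + d)) = (a + b) + (c + d)" by simp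
  have ab: "a + b \<in> Msa V n" and cd: "c + d \<in> Msa V n" using sa Msa_add by auto
  have dc: "(c + d) - c = d" "(c + d) - d = c" using cc by (auto intro!: eq_matI)
  have oc: "mabs V ((a + b) - c) = (a + b) + c"
    using orthogonal_mono[OF n ab cd o pos(3)] pos(4) dc by simp
  have od: "mabs V ((a + b) - d) = (a + b) + d"
    using orthogonal_mono[OF n ab cd o pos(4)] pos(3) dc by simp
  have ba: "(a + b) - a = b" "(a + b) - b = a" using cc by (auto intro!: eq_matI)
  have da: "mabs V (d - a) = d + a"
    using orthogonal_mono[OF n sa(4) ab orthogonal_sym[OF n ab sa(4) od] pos(1)] pos(2) ba by simp
  have cb: "mabs V (c - b) = c + b"
    using orthogonal_mono[OF n sa(3) ab orthogonal_sym[OF n ab sa(3) oc] pos(2)] pos(1) ba by simp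
  have ab': "mabs V (a - b) = a + b"
  proof -
    have "a - b = rscale V 2 x"
      using XYc xy unfolding rscale_2 a_def b_def by (auto intro!: eq_matI)
    then show ?thesis using mabs_rscale[OF n x, of 2] X2 by (simp add: X_def)
  qed
  have cd': "mabs V (c - d) = c + d"
  proof -
    have "c - d = rscale V 2 y"
      using XYc xy unfolding rscale_2 c_def d_def by (auto intro!: eq_matI)
    then show ?thesis using mabs_rscale[OF n y, of 2] Y2 by (simp add: Y_def)
  qed
  have "mabs V (a - (b + d)) = a + (b + d)"
    using orthogonal_add[OF n sa(1) pos(2,4) ab' orthogonal_sym[OF n sa(4,1) da]] .
  moreover have "mabs V (c - (b + d)) = c + (b + d)"
    using orthogonal_add[OF n sa(3) pos(2,4) cb cd'] .
  moreover have bd: "b + d \<in> Msa V n" using sa Msa_add by auto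
  ultimately have "mabs V ((b + d) - (a + c)) = (b + d) + (a + c)"
    using orthogonal_add[OF n bd pos(1,3)] orthogonal_sym[OF n _ bd] sa by blast
  moreover have ac: "a + c \<in> Msa V n" using sa Msa_add by auto
  ultimately have "mabs V ((a + c) - (b + d)) = (a + c) + (b + d)"
    using orthogonal_sym[OF n bd ac] by blast
  moreover have "(a + c) - (b + d) = rscale V 2 (x + y)" "(a + c) + (b + d) = rscale V 2 (X + Y)"
    using XYc xy unfolding rscale_2 a_def b_def c_def d_def by (auto intro!: eq_matI)
  ultimately have "rscale V 2 (mabs V (x + y)) = rscale V 2 (X + Y)"
    using mabs_rscale[OF n Msa_add[OF x y], of 2] by simp
  then show ?thesis
    using rscale_2_inject[of "mabs V (x + y)" n n "X + Y"] XYc xy n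
    by (simp add: X_def Y_def)
qed

lemma mabs_lmul_contraction:
  assumes pos: "0 < m" "0 < n" "0 < r" and v: "v \<in> carrier_mat m n" and A: "A \<in> carrier_mat r m"
    and norm: "op_norm A \<le> 1"
  shows "mle V n (mabs V (lmul V A v)) (mabs V v)"
proof -
  have Av: "lmul V A v \<in> carrier_mat r n" using A v by simp
  have c: "mabs V v \<in> carrier_mat n n" and av: "mabs V v \<in> mcone V n"
    using pos v mabs_carrier mabs_cone by auto
  have "mle V n (mabs V (rmul V (lmul V A v) (1\<^sub>m n)))
      (rscale V (op_norm A) (mabs V (rmul V (mabs V v) (1\<^sub>m n))))"
    by (rule mabs_mul[OF pos(1,2,3,2) v A]) simp
  then have 1: "mle V n (mabs V (lmul V A v)) (rscale V (op_norm A) (mabs V v))"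
    using rmul_one[OF Av] rmul_one[OF c] mabs_of_cone[OF pos(2) av] by simp
  have "rscale V (1 - op_norm A) (mabs V v) \<in> mcone V n"
    using norm pos av by (intro cone_rscale) auto
  also have "rscale V (1 - op_norm A) (mabs V v) = mabs V v - rscale V (op_norm A) (mabs V v)"
    by (rule eq_matI) (auto simp: vs.scale_left_diff_distrib)
  finally have "mle V n (rscale V (op_norm A) (mabs V v)) (mabs V v)"
    using cone_Msa[OF pos(2) av] Msa_rscale by (auto simp: mle_def)
  with 1 show ?thesis using mle_trans pos by blast
qed

lemma mabs_rmul_contraction:
  assumes pos: "0 < m" "0 < n" "0 < s" and v: "v \<in> carrier_mat m n" and B: "B \<in> carrier_mat n s"
  shows "mle V s (mabs V (rmul V v B)) (mabs V (rmul V (mabs V v) B))"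
proof -
  let ?w = "mabs V (rmul V (mabs V v) B)"
  have n1: "op_norm (1\<^sub>m m) \<le> 1" by (rule isometry_op_norm_le_1) auto
  have vB: "rmul V v B \<in> carrier_mat m s" using v B by simp
  have "mabs V v \<in> carrier_mat n n" using pos v by simp
  then have w: "rmul V (mabs V v) B \<in> carrier_mat n s" using B by simp
  then have wc: "?w \<in> mcone V s" using pos mabs_cone by blast
  have 1: "mle V s (mabs V (rmul V v B)) (rscale V (op_norm (1\<^sub>m m)) ?w)"
    using mabs_mul[OF pos(1,2,1,3) v _ B, of "1\<^sub>m m"] lmul_one[OF v] by simp
  have "rscale V (1 - op_norm (1\<^sub>m m)) ?w \<in> mcone V s"
    using n1 pos wc by (intro cone_rscale) auto
  also have "rscale V (1 - op_norm (1\<^sub>m m)) ?w = ?w - rscale V (op_norm (1\<^sub>m m)) ?w"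
    by (rule eq_matI) (auto simp: vs.scale_left_diff_distrib)
  finally have "mle V s (rscale V (op_norm (1\<^sub>m m)) ?w) ?w"
    using cone_Msa[OF pos(3) wc] Msa_rscale by (auto simp: mle_def)
  with 1 show ?thesis using mle_trans pos by blast
qed

end

context absolute_matrix_order_unit_space
begin

text \<open>Both \<open>A\<close> and its left inverse \<open>A\<^sup>*\<close> are contractions.\<close>

lemma mabs_lmul_isometry:
  assumes pos: "0 < m" "0 < n" "0 < r" and v: "v \<in> carrier_mat m n" and A: "A \<in> carrier_mat r m"
    and iso: "mat_adjoint A * A = 1\<^sub>m m"
  shows "mabs V (lmul V A v) = mabs V v"
proof (rule mle_antisym[OF pos(2)])
  show "mle V n (mabs V (lmul V A v)) (mabs V v)"
    by (rule mabs_lmul_contraction[OF pos v A isometry_op_norm_le_1[OF A iso]])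
  have Av: "lmul V A v \<in> carrier_mat r n" using A v by simp
  have "lmul V (mat_adjoint A) (lmul V A v) = v"
    using lmul_lmul[OF _ A v, of "mat_adjoint A" m] A v iso by simp
  then show "mle V n (mabs V v) (mabs V (lmul V A v))"
    using mabs_lmul_contraction[OF pos(3,2,1) Av _ coisometry_op_norm_le_1[OF A iso]] A by simp
qed

text \<open>One inequality comes from the two contraction estimates for \<open>w U\<^sup>*\<close>; applied to \<open>U\<^sup>*\<close> and
  \<open>U w U\<^sup>*\<close> it gives the other one.\<close>

lemma mabs_unitary_conj:
  assumes n: "0 < n" and U: "U \<in> carrier_mat n n" and uni: "mat_adjoint U * U = 1\<^sub>m n"
    "U * mat_adjoint U = 1\<^sub>m n" and w: "w \<in> carrier_mat n n"
  shows "mabs V (conj_by V U w) = conj_by V U (mabs V w)"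
proof (rule mle_antisym[OF n])
  have le: "mle V n (mabs V (conj_by V U w)) (conj_by V U (mabs V w))"
    if U: "U \<in> carrier_mat n n" and uni: "mat_adjoint U * U = 1\<^sub>m n"
      and w: "w \<in> carrier_mat n n" for U w
  proof -
    have U': "mat_adjoint U \<in> carrier_mat n n" using U by simp
    have w': "mabs V w \<in> carrier_mat n n" using n w by simp
    have eq: "mabs V (rmul V x (mat_adjoint U)) = mabs V (conj_by V U x)" if "x \<in> carrier_mat n n" for x
      using mabs_lmul_isometry[OF n n n _ U uni, of "rmul V x (mat_adjoint U)"] that U'
      by (simp add: conj_by_def rmul_lmul[OF U that U'])
    have "mle V n (mabs V (rmul V w (mat_adjoint U))) (mabs V (rmul V (mabs V w) (mat_adjoint U)))"
      by (rule mabs_rmul_contraction[OF n n n w U'])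
    moreover have "conj_by V U (mabs V w) \<in> mcone V n"
      using cone_conj_by n U mabs_cone w by blast
    ultimately show ?thesis using eq[OF w] eq[OF w'] mabs_of_cone[OF n] by simp
  qed
  show "mle V n (mabs V (conj_by V U w)) (conj_by V U (mabs V w))" by (rule le[OF U uni(1) w])
  have U': "mat_adjoint U \<in> carrier_mat n n" and Uw: "conj_by V U w \<in> carrier_mat n n"
    using U w by auto
  have aUw: "mabs V (conj_by V U w) \<in> carrier_mat n n" using n Uw by simp
  have "mle V n (mabs V w) (conj_by V (mat_adjoint U) (mabs V (conj_by V U w)))"
    using le[OF U' _ Uw] uni(2) conj_by_isometry_cancel[OF U uni(1) w] by simp
  then have "mle V n (conj_by V U (mabs V w))
      (conj_by V U (conj_by V (mat_adjoint U) (mabs V (conj_by V U w))))"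
    using mle_conj_by[OF n n U] by blast
  also have "conj_by V U (conj_by V (mat_adjoint U) (mabs V (conj_by V U w))) = mabs V (conj_by V U w)"
    using conj_by_isometry_cancel[OF U' _ aUw] uni(2) by simp
  finally show "mle V n (conj_by V U (mabs V w)) (mabs V (conj_by V U w))" .
qed

lemma mabs_sa_dilation:
  assumes "0 < m" "0 < n" and v: "v \<in> carrier_mat m n"
  shows "mabs V (sa_dilation V v) = dsum (mabs V (mstar V v)) (mabs V v)"
proof -
  have "mabs V (sa_dilation V v) = mabs V (lmul V (swap_mat m n) (sa_dilation V v))"
    using assms swap_mat_isometry[of m n]
    by (intro mabs_lmul_isometry[symmetric, of "m + n" "m + n" "n + m"]) auto
  also have "\<dots> = dsum (mabs V (mstar V v)) (mabs V v)"
    unfolding lmul_swap_dilation[OF v] using assms by (intro mabs_dsum[of n m m n]) auto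
  finally show ?thesis .
qed

text \<open>If \<open>|v| = 0\<close>, then the absolute value of the self-adjoint dilation of \<open>v\<close> is \<open>|v\<^sup>*| \<oplus> 0\<close>.  Its sum
  with the dilation is positive with zero lower right corner, so the upper right corner \<open>v\<close> vanishes.\<close>

lemma mabs_eq_0D:
  assumes mn: "0 < m" "0 < n" and v: "v \<in> carrier_mat m n" and 0: "mabs V v = 0\<^sub>m n n"
  shows "v = 0\<^sub>m m n"
proof -
  let ?a = "mabs V (mstar V v)" and ?B = "incl2 m n"
  have a: "?a \<in> carrier_mat m m" using mn v by (intro mabs_carrier[of n m]) auto
  define M where "M = dsum ?a (0\<^sub>m n n) + sa_dilation V v"
  have dil: "sa_dilation V v \<in> carrier_mat (m + n) (m + n)" using v by simp
  have M: "M \<in> mcone V (m + n)"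
    using mabs_ge(1)[OF _ sa_dilation_Msa[OF v]] mn mabs_sa_dilation[OF mn v] 0
    by (simp add: M_def)
  have Mc: "M \<in> carrier_mat (m + n) (m + n)" using dil a by (simp add: M_def)
  have "conj_by V (mat_adjoint ?B) M = 0\<^sub>m n n"
  proof (rule eq_matI)
    fix i j assume "i < dim_row (0\<^sub>m n n :: 'v mat)" "j < dim_col (0\<^sub>m n n :: 'v mat)"
    then have ij: "i < n" "j < n" by auto
    have "conj_by V (mat_adjoint ?B) M = lmul V (mat_adjoint ?B) (rmul V M ?B)"
      unfolding conj_by_def mat_adjoint_adjoint
      by (rule rmul_lmul[OF _ Mc, of _ n _ n]) auto
    also have "\<dots> $$ (i,j) = M $$ (m + i, m + j)"
      using ij Mc by (simp add: lmul_incl2_adjoint_index[of _ m n n] rmul_incl2_index[of _ "m + n" m n])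
    also have "\<dots> = 0"
      using ij v a by (auto simp: M_def dsum_def sa_dilation_def)
    finally show "conj_by V (mat_adjoint ?B) M $$ (i,j) = 0\<^sub>m n n $$ (i,j)" using ij by simp
  qed (auto simp: conj_by_def incl2_def)
  then have MB: "rmul V M ?B = 0\<^sub>m (m + n) n"
    using mn M by (intro cone_null) auto
  show "v = 0\<^sub>m m n"
  proof (rule eq_matI)
    fix i j assume "i < dim_row (0\<^sub>m m n :: 'v mat)" "j < dim_col (0\<^sub>m m n :: 'v mat)"
    then have ij: "i < m" "j < n" by auto
    then have "v $$ (i,j) = M $$ (i, m + j)"
      using v a by (auto simp: M_def dsum_def sa_dilation_def)
    also have "\<dots> = rmul V M ?B $$ (i,j)" using rmul_incl2_index[OF Mc] ij by simp
    finally show "v $$ (i,j) = 0\<^sub>m m n $$ (i,j)" using MB ij by simp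
  qed (use v in auto)
qed

end


section \<open>Order projections and their equivalence\<close>

context absolute_matrix_order_unit_space
begin

lemma munit_cone:
  assumes "0 < n"
  shows "munit V n \<in> mcone V n"
proof -
  have "munit V 1 = mat1 (ounit V)" by (rule eq_matI) (auto simp: munit_def mat1_def)
  then have c1: "munit V 1 \<in> mcone V 1" using unit_pos by (simp add: Vpos_def)
  show ?thesis using assms
  proof (induction n rule: nat_induct_non_zero)
    case 1
    show ?case using c1 by simp
  next
    case (Suc n)
    \<comment> \<open>The absolute value of \<open>e\<^sup>n \<oplus> e\<close> is computed blockwise, and absolute values lie in the cone.\<close>
    have "mabs V (munit V (Suc n)) = munit V (Suc n)"
      using mabs_dsum[of n n 1 1 "munit V n" "munit V 1"] Suc mabs_of_cone[of n "munit V n"]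
        mabs_of_cone[OF _ c1] munit_dsum[of n 1]
      by simp
    then show ?case using mabs_cone[of "Suc n" "Suc n" "munit V (Suc n)"] by simp
  qed
qed

lemma OP_carrier: "p \<in> OP V n \<Longrightarrow> p \<in> carrier_mat n n"
  by (simp add: OP_def)

lemma OP_Msa: "p \<in> OP V n \<Longrightarrow> p \<in> Msa V n"
  by (simp add: OP_def Msa_def)

text \<open>A self-adjoint \<open>p\<close> is an order projection iff \<open>e\<^sup>n - p\<close> and \<open>p\<close> are orthogonal.\<close>

lemma OP_mabs_iff:
  assumes n: "0 < n"
  shows "p \<in> OP V n \<longleftrightarrow> p \<in> Msa V n \<and> mabs V ((munit V n - p) - p) = (munit V n - p) + p"
proof -
  have "mabs V (rscale V 2 p - munit V n) = mabs V ((munit V n - p) - p) \<and> (munit V n - p) + p = munit V n"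
    if p: "p \<in> Msa V n"
  proof -
    note pc = MsaD(1)[OF p]
    have "(munit V n - p) - p = - (rscale V 2 p - munit V n)"
      unfolding rscale_2 using pc munit_carrier[of V n] by (intro eq_matI) auto
    moreover have "rscale V 2 p - munit V n \<in> Msa V n"
      using n p munit_cone cone_Msa Msa_rscale Msa_minus by blast
    moreover have "(munit V n - p) + p = munit V n"
      using pc munit_carrier[of V n] by (intro eq_matI) auto
    ultimately show ?thesis using mabs_uminus n by simp
  qed
  then show ?thesis by (auto simp: OP_def Msa_def)
qed

lemma OP_cone:
  assumes n: "0 < n" and p: "p \<in> OP V n"
  shows "p \<in> mcone V n"
proof -
  have pc: "p \<in> carrier_mat n n" using OP_carrier p .
  have "rscale V 2 p - munit V n \<in> Msa V n"
    using n OP_Msa[OF p] munit_cone cone_Msa Msa_rscale Msa_minus by blast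
  then have "munit V n + (rscale V 2 p - munit V n) \<in> mcone V n"
    using mabs_ge(1)[OF n] p by (force simp: OP_def)
  also have "munit V n + (rscale V 2 p - munit V n) = rscale V 2 p"
    using pc munit_carrier[of V n] by (intro eq_matI) auto
  finally have "rscale V (1/2) (rscale V 2 p) \<in> mcone V n"
    using cone_rscale[OF n, of "1/2"] by simp
  then show ?thesis by (simp add: rscale_rscale)
qed

lemma mabs_OP: "0 < n \<Longrightarrow> p \<in> OP V n \<Longrightarrow> mabs V p = p"
  using OP_cone mabs_of_cone by blast

lemma OP_zero: "0 < n \<Longrightarrow> 0\<^sub>m n n \<in> OP V n"
proof -
  assume n: "0 < n"
  have "rscale V 2 (0\<^sub>m n n) - munit V n = - munit V n"
    using munit_carrier[of V n] by (intro eq_matI) auto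
  then show ?thesis
    using n mabs_uminus[OF n cone_Msa[OF n munit_cone[OF n]]] mabs_of_cone[OF n munit_cone[OF n]]
    by (simp add: OP_def)
qed

text \<open>As \<open>p - q\<close> lies below both \<open>p\<close> and \<open>e\<^sup>n - q\<close>, it is orthogonal to \<open>e\<^sup>n - p\<close> and to \<open>q\<close>, hence to
  their sum \<open>e\<^sup>n - (p - q)\<close>.\<close>

lemma OP_diff:
  assumes n: "0 < n" and p: "p \<in> OP V n" and q: "q \<in> OP V n" and le: "p - q \<in> mcone V n"
  shows "p - q \<in> OP V n" "mabs V (q - (p - q)) = p"
proof -
  let ?e = "munit V n"
  have pc: "p \<in> carrier_mat n n" and qc: "q \<in> carrier_mat n n" and ec: "?e \<in> carrier_mat n n"
    using OP_carrier p q by auto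
  have psa: "p \<in> Msa V n" and qsa: "q \<in> Msa V n" using OP_Msa p q by auto
  have epsa: "?e - p \<in> Msa V n" and eqsa: "?e - q \<in> Msa V n"
    using psa qsa n munit_cone cone_Msa Msa_minus by auto
  have pq: "p - q \<in> Msa V n" using psa qsa Msa_minus by blast
  have pp: "mabs V ((?e - p) - p) = (?e - p) + p" using OP_mabs_iff n p by blast
  have qq: "mabs V ((?e - q) - q) = (?e - q) + q" using OP_mabs_iff n q by blast
  have ep: "?e - p \<in> mcone V n"
  proof -
    have "mabs V ((?e - p) - p) + ((?e - p) - p) \<in> mcone V n"
      using mabs_ge(1)[OF n Msa_minus[OF epsa psa]] .
    also have "mabs V ((?e - p) - p) + ((?e - p) - p) = rscale V 2 (?e - p)"
      unfolding pp rscale_2 using pc ec by (intro eq_matI) auto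
    finally have "rscale V (1/2) (rscale V 2 (?e - p)) \<in> mcone V n"
      using cone_rscale[OF n, of "1/2"] by simp
    then show ?thesis by (simp add: rscale_rscale)
  qed
  have "(?e - q) - (p - q) = ?e - p" "p - (p - q) = q"
    using pc qc ec by (auto intro!: eq_matI)
  note d = this
  have "mabs V (q - (p - q)) = q + (p - q)"
    using orthogonal_mono[OF n qsa eqsa orthogonal_sym[OF n eqsa qsa qq] le] ep d by simp
  moreover have "q + (p - q) = p" using pc qc by (intro eq_matI) auto
  ultimately show orth: "mabs V (q - (p - q)) = p" by simp
  then have 1: "mabs V ((p - q) - q) = (p - q) + q"
    using orthogonal_sym[OF n qsa pq] \<open>q + (p - q) = p\<close> by simp
  have "mabs V ((?e - p) - (p - q)) = (?e - p) + (p - q)"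
    using orthogonal_mono[OF n epsa psa pp le] d OP_cone[OF n q] by simp
  then have 2: "mabs V ((p - q) - (?e - p)) = (p - q) + (?e - p)"
    using orthogonal_sym[OF n epsa pq] by simp
  have "mabs V ((p - q) - ((?e - p) + q)) = (p - q) + ((?e - p) + q)"
    using orthogonal_add[OF n pq ep OP_cone[OF n q] 2 1] .
  moreover have "(?e - p) + q = ?e - (p - q)" using pc qc ec by (intro eq_matI) auto
  ultimately have "mabs V ((p - q) - (?e - (p - q))) = (p - q) + (?e - (p - q))" by simp
  then have "mabs V ((?e - (p - q)) - (p - q)) = (?e - (p - q)) + (p - q)"
    using orthogonal_sym[OF n pq] pq n munit_cone cone_Msa Msa_minus by blast
  then show "p - q \<in> OP V n" using OP_mabs_iff[OF n] pq by blast
qed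

lemma OP_dsum_iff:
  assumes mn: "0 < m" "0 < n" and p: "p \<in> carrier_mat m m" and q: "q \<in> carrier_mat n n"
  shows "dsum p q \<in> OP V (m + n) \<longleftrightarrow> p \<in> OP V m \<and> q \<in> OP V n"
proof -
  let ?p = "rscale V 2 p - munit V m" and ?q = "rscale V 2 q - munit V n"
  have c: "?p \<in> carrier_mat m m" "?q \<in> carrier_mat n n"
    using p q munit_carrier minus_carrier_mat by blast+
  have "rscale V 2 (dsum p q) - munit V (m + n) = dsum ?p ?q"
    unfolding munit_dsum[symmetric] using p q munit_carrier[of V m] munit_carrier[of V n]
    by (intro eq_matI) (auto simp: dsum_def)
  then have "mabs V (rscale V 2 (dsum p q) - munit V (m + n)) = dsum (mabs V ?p) (mabs V ?q)"
    using mabs_dsum[OF mn(1,1) mn(2,2) c] by simp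
  then have "mabs V (rscale V 2 (dsum p q) - munit V (m + n)) = munit V (m + n) \<longleftrightarrow>
      mabs V ?p = munit V m \<and> mabs V ?q = munit V n"
    unfolding munit_dsum[symmetric]
    using dsum_inject[OF mabs_carrier[OF mn(1,1) c(1)] munit_carrier mabs_carrier[OF mn(2,2) c(2)] munit_carrier]
    by auto
  moreover have "mstar V (dsum p q) = dsum p q \<longleftrightarrow> mstar V p = p \<and> mstar V q = q"
    unfolding mstar_dsum[OF p q]
    using dsum_inject[OF mstar_carrier[OF p] p mstar_carrier[OF q] q] by auto
  ultimately show ?thesis using p q by (auto simp: OP_def)
qed

lemma OP_unitary_conj:
  assumes n: "0 < n" and U: "U \<in> carrier_mat n n" and uni: "mat_adjoint U * U = 1\<^sub>m n"
    "U * mat_adjoint U = 1\<^sub>m n" and p: "p \<in> OP V n"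
  shows "conj_by V U p \<in> OP V n"
proof -
  have pc: "p \<in> carrier_mat n n" using OP_carrier p .
  have c: "rscale V 2 p - munit V n \<in> carrier_mat n n"
    by (intro minus_carrier_mat munit_carrier)
  have "rscale V 2 (conj_by V U p) - munit V n = conj_by V U (rscale V 2 p - munit V n)"
    using conj_by_minus[OF U rscale_carrier[OF pc] munit_carrier] conj_by_rscale[OF U pc]
      conj_by_unitary_munit[OF U uni(2)] by simp
  also have "mabs V \<dots> = conj_by V U (munit V n)"
    using mabs_unitary_conj[OF n U uni c] p by (simp add: OP_def)
  also have "\<dots> = munit V n" using conj_by_unitary_munit[OF U uni(2)] .
  finally show ?thesis
    using p pc U by (simp add: OP_def mstar_conj_by)
qed

text \<open>For an isometry \<open>A\<close>, Halmos' unitary interchanges \<open>0 \<oplus> q\<close> and \<open>A q A\<^sup>* \<oplus> 0\<close>.\<close>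

lemma OP_conj_by_iff:
  assumes mn: "0 < m" "0 < n" and A: "A \<in> carrier_mat m n" and iso: "mat_adjoint A * A = 1\<^sub>m n"
    and q: "q \<in> carrier_mat n n"
  shows "conj_by V A q \<in> OP V m \<longleftrightarrow> q \<in> OP V n"
proof -
  let ?U = "halmos A"
  note U = halmos[OF A iso]
  have Aq: "conj_by V A q \<in> carrier_mat m m" using A q by simp
  have z: "dsum (0\<^sub>m m m) q \<in> carrier_mat (m + n) (m + n)" using q by simp
  have U1: "conj_by V ?U (dsum (0\<^sub>m m m) q) = dsum (conj_by V A q) (0\<^sub>m n n)"
    using conj_by_conj_by[OF U(1) incl_carrier(2) q] conj_by_conj_by[OF incl_carrier(1) A q] Aq
    by (simp add: U(4) conj_by_incl1[OF Aq, symmetric] conj_by_incl2[OF q, symmetric])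
  have U2: "conj_by V ?U (dsum (conj_by V A q) (0\<^sub>m n n)) = dsum (0\<^sub>m m m) q"
    using conj_by_conj_by[OF U(1,1) z] z U1 by (simp add: U(3))
  have "dsum (0\<^sub>m m m) q \<in> OP V (m + n) \<longleftrightarrow> dsum (conj_by V A q) (0\<^sub>m n n) \<in> OP V (m + n)"
    using OP_unitary_conj[OF _ U(1)] U(2,3) U1 U2 mn
    by (metis add_gr_0)
  then show ?thesis
    using OP_dsum_iff[OF mn _ q, of "0\<^sub>m m m"] OP_dsum_iff[OF mn Aq, of "0\<^sub>m n n"] OP_zero mn by auto
qed

lemma proj_equivI:
  assumes "v \<in> carrier_mat m n" "p \<in> OP V m" "q \<in> OP V n" "mabs V (mstar V v) = p" "mabs V v = q"
  shows "proj_equiv V p q"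
  using assms OP_carrier[OF assms(2)] OP_carrier[OF assms(3)]
  by (auto simp: proj_equiv_def ParIso_def)

lemma proj_equivE:
  assumes "proj_equiv V p q" "p \<in> OP V m" "q \<in> OP V n"
  obtains v where "v \<in> ParIso V m n" "v \<in> carrier_mat m n" "mabs V (mstar V v) = p" "mabs V v = q"
  using assms OP_carrier[OF assms(2)] OP_carrier[OF assms(3)]
  by (auto simp: proj_equiv_def ParIso_def)

lemma ParIso_mstar: "v \<in> ParIso V m n \<Longrightarrow> mstar V v \<in> ParIso V n m"
  by (auto simp: ParIso_def)

lemma proj_equiv_sym:
  assumes "p \<in> OP V m" "q \<in> OP V n" "proj_equiv V p q"
  shows "proj_equiv V q p"
proof -
  obtain v where "v \<in> carrier_mat m n" "mabs V (mstar V v) = p" "mabs V v = q"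
    using proj_equivE assms by metis
  then show ?thesis using assms by (intro proj_equivI[of "mstar V v" n m]) auto
qed

text \<open>Given symmetry, condition (T) is transitivity of the equivalence of projections.\<close>

lemma proj_equiv_trans:
  assumes T: "condition_T V" and mnl: "0 < m" "0 < n" "0 < l"
    and OP: "p \<in> OP V m" "q \<in> OP V n" "r \<in> OP V l"
    and "proj_equiv V p q" "proj_equiv V q r"
  shows "proj_equiv V p r"
proof -
  obtain u where u: "u \<in> ParIso V m n" "mabs V (mstar V u) = p" "mabs V u = q"
    using proj_equivE assms by metis
  obtain v where v: "v \<in> ParIso V l n" "mabs V (mstar V v) = r" "mabs V v = q"
    using proj_equivE proj_equiv_sym assms by metis
  have "\<exists>w \<in> ParIso V m l. mabs V (mstar V w) = mabs V (mstar V u) \<and> mabs V w = mabs V (mstar V v)"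
    using T[unfolded condition_T_def, rule_format, OF mnl(3) mnl(1) mnl(2) u(1) v(1)] u(3) v(3) by simp
  then obtain w where w: "w \<in> ParIso V m l" "mabs V (mstar V w) = p" "mabs V w = r"
    using u v by auto
  then show ?thesis using OP by (intro proj_equivI[of w m l]) (auto simp: ParIso_def)
qed

text \<open>The equivalence is implemented by the partial isometry \<open>p A\<^sup>*\<close>.\<close>

lemma proj_equiv_conj_by:
  assumes mn: "0 < m" "0 < n" and A: "A \<in> carrier_mat m n" and iso: "mat_adjoint A * A = 1\<^sub>m n"
    and p: "p \<in> OP V n"
  shows "proj_equiv V p (conj_by V A p)"
proof -
  have pc: "p \<in> carrier_mat n n" and A': "mat_adjoint A \<in> carrier_mat n m"
    and ps: "mstar V p = p"
    using OP_carrier[OF p] A OP_Msa[OF p] MsaD by auto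
  have cA: "conj_by V A p \<in> OP V m" using OP_conj_by_iff[OF mn A iso pc] p by simp
  have v: "rmul V p (mat_adjoint A) \<in> carrier_mat n m" using pc A' by simp
  have "mabs V (rmul V p (mat_adjoint A)) = mabs V (lmul V A (rmul V p (mat_adjoint A)))"
    using mabs_lmul_isometry[OF mn(2,1,1) v A iso] by simp
  also have "\<dots> = conj_by V A p"
    using mabs_OP[OF mn(1) cA] by (simp add: conj_by_def rmul_lmul[OF A pc A'])
  finally have 1: "mabs V (rmul V p (mat_adjoint A)) = conj_by V A p" .
  have "mstar V (rmul V p (mat_adjoint A)) = lmul V A p"
    by (simp add: mstar_rmul[OF pc A'] ps)
  then have 2: "mabs V (mstar V (rmul V p (mat_adjoint A))) = p"
    using mabs_lmul_isometry[OF mn(2,2,1) pc A iso] mabs_OP mn p by simp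
  show ?thesis by (rule proj_equivI[OF v p cA 2 1])
qed

text \<open>A positive \<open>q\<close> below \<open>A p A\<^sup>*\<close> vanishes on the defect projection \<open>D = 1 - A A\<^sup>*\<close>, because
  \<open>D q D \<le> D A p A\<^sup>* D = 0\<close>; so \<open>q\<close> comes from a matrix of the size of \<open>p\<close>.\<close>

lemma below_conj_by:
  assumes mn: "0 < m" "0 < n" and A: "A \<in> carrier_mat m n" and iso: "mat_adjoint A * A = 1\<^sub>m n"
    and p: "p \<in> carrier_mat n n" and q: "q \<in> mcone V m" and le: "conj_by V A p - q \<in> mcone V m"
  shows "conj_by V A (conj_by V (mat_adjoint A) q) = q"
proof -
  let ?D = "1\<^sub>m m - A * mat_adjoint A"
  note D = defect_projection[OF A iso]
  have A': "mat_adjoint A \<in> carrier_mat n m" and AA: "A * mat_adjoint A \<in> carrier_mat m m"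
    using A by auto
  have qc: "q \<in> carrier_mat m m" and qs: "mstar V q = q"
    using MsaD[OF cone_Msa[OF mn(1) q]] by auto
  have Ap: "conj_by V A p \<in> carrier_mat m m" using A p by simp
  have Dq: "conj_by V ?D q \<in> mcone V m" using cone_conj_by mn D(1) q by blast
  have Dqc: "conj_by V ?D q \<in> carrier_mat m m" using D(1) qc by simp
  have "conj_by V ?D (conj_by V A p) = conj_by V (0\<^sub>m m n) p"
    using conj_by_conj_by[OF D(1) A p] D(3) by simp
  also have "\<dots> = 0\<^sub>m m m" using p by (simp add: conj_by_def rmul_zero_left[of _ n m])
  finally have "conj_by V ?D (conj_by V A p - q) = 0\<^sub>m m m - conj_by V ?D q"
    using conj_by_minus[OF D(1) Ap qc] by simp
  also have "\<dots> = - conj_by V ?D q" using Dqc by (intro eq_matI) auto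
  finally have "- conj_by V ?D q \<in> mcone V m" using cone_conj_by[OF mn(1,1) D(1) le] by simp
  then have "conj_by V (mat_adjoint ?D) q = 0\<^sub>m m m" using cone_proper[OF mn(1) Dq] D(2) by simp
  then have "rmul V q ?D = 0\<^sub>m m m" using cone_null[OF mn(1,1) q D(1)] by simp
  then have "rmul V q (1\<^sub>m m) - rmul V q (A * mat_adjoint A) = 0\<^sub>m m m"
    using rmul_minus_right[OF qc _ AA, of "1\<^sub>m m"] by simp
  then have r: "rmul V q (A * mat_adjoint A) = q"
    using mat_eq_diff_iff[OF qc rmul_carrier[OF qc AA]] rmul_one[OF qc] by simp
  have AAs: "mat_adjoint (A * mat_adjoint A) = A * mat_adjoint A"
    using mat_adjoint_mult[OF A A'] by simp
  have "lmul V (A * mat_adjoint A) q = q"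
    using arg_cong[OF r, of "mstar V"] mstar_rmul[OF qc AA] by (simp add: qs AAs)
  then show ?thesis
    using conj_by_conj_by[OF A A' qc] r by (simp add: conj_by_def AAs)
qed

lemma infinite_projection_iff:
  assumes "0 < n" "p \<in> OP V n"
  shows "infinite_projection V p \<longleftrightarrow> (\<exists>q \<in> OP V n. p - q \<in> mcone V n \<and> q \<noteq> p \<and> proj_equiv V p q)"
  using assms OP_carrier[OF assms(2)] OP_Msa
  by (auto simp: infinite_projection_def OPinf_def mle_def)

text \<open>Conjugation by an isometry is a bijection from the projections below \<open>p\<close> to those below
  \<open>A p A\<^sup>*\<close>, and replaces each of them by an equivalent one.\<close>

lemma infinite_projection_conj_by_iff:
  assumes T: "condition_T V" and mn: "0 < m" "0 < n" and A: "A \<in> carrier_mat m n"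
    and iso: "mat_adjoint A * A = 1\<^sub>m n" and p: "p \<in> OP V n"
  shows "infinite_projection V (conj_by V A p) \<longleftrightarrow> infinite_projection V p"
proof -
  have pc: "p \<in> carrier_mat n n" and A': "mat_adjoint A \<in> carrier_mat n m"
    using OP_carrier[OF p] A by auto
  have Ap: "conj_by V A p \<in> OP V m" using OP_conj_by_iff[OF mn A iso pc] p by simp
  show ?thesis
  proof
    assume "infinite_projection V p"
    then obtain q where q: "q \<in> OP V n" "p - q \<in> mcone V n" "q \<noteq> p" "proj_equiv V p q"
      using infinite_projection_iff mn p by blast
    have qc: "q \<in> carrier_mat n n" using OP_carrier q by blast
    have Aq: "conj_by V A q \<in> OP V m" using OP_conj_by_iff[OF mn A iso qc] q by simp
    have "conj_by V A p - conj_by V A q \<in> mcone V m"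
      using cone_conj_by[OF mn A q(2)] conj_by_minus[OF A pc qc] by simp
    moreover have "conj_by V A q \<noteq> conj_by V A p"
      using conj_by_isometry_cancel[OF A iso pc] conj_by_isometry_cancel[OF A iso qc] q(3) by metis
    moreover have "proj_equiv V (conj_by V A p) (conj_by V A q)"
      using proj_equiv_trans[OF T mn(1,2,2) Ap p q(1)] proj_equiv_sym[OF p Ap]
        proj_equiv_conj_by[OF mn A iso] p q(1,4) proj_equiv_trans[OF T mn(1,2,1) Ap q(1) Aq]
      by blast
    ultimately show "infinite_projection V (conj_by V A p)"
      using infinite_projection_iff[OF mn(1) Ap] Aq by blast
  next
    assume "infinite_projection V (conj_by V A p)"
    then obtain q' where q': "q' \<in> OP V m" "conj_by V A p - q' \<in> mcone V m"
        "q' \<noteq> conj_by V A p" "proj_equiv V (conj_by V A p) q'"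
      using infinite_projection_iff[OF mn(1) Ap] by blast
    define q where "q = conj_by V (mat_adjoint A) q'"
    have q'c: "q' \<in> carrier_mat m m" using OP_carrier q' by blast
    have qc: "q \<in> carrier_mat n n" using conj_by_carrier[OF A' q'c] by (simp add: q_def)
    have Aq: "conj_by V A q = q'"
      unfolding q_def using below_conj_by[OF mn A iso pc OP_cone[OF mn(1) q'(1)] q'(2)] .
    have q: "q \<in> OP V n" using OP_conj_by_iff[OF mn A iso qc] q'(1) Aq by simp
    have "p - q = conj_by V (mat_adjoint A) (conj_by V A p - q')"
      using conj_by_minus[OF A' conj_by_carrier[OF A pc] q'c] conj_by_isometry_cancel[OF A iso pc]
      by (simp add: q_def)
    then have "p - q \<in> mcone V n" using cone_conj_by[OF mn(2,1) A' q'(2)] by simp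
    moreover have "q \<noteq> p" using Aq q'(3) by auto
    moreover have "proj_equiv V p q"
    proof -
      have "proj_equiv V p q'"
        using proj_equiv_trans[OF T mn(2,1,1) p Ap q'(1)] proj_equiv_conj_by[OF mn A iso p] q'(4) by blast
      moreover have "proj_equiv V q' q"
        using proj_equiv_sym[OF q q'(1)] proj_equiv_conj_by[OF mn A iso q] Aq by simp
      ultimately show ?thesis using proj_equiv_trans[OF T mn(2,1,2) p q'(1) q] by blast
    qed
    ultimately show "infinite_projection V p"
      using infinite_projection_iff[OF mn(2) p] q by blast
  qed
qed

text \<open>Additivity of the absolute value on orthogonal rectangular matrices, from the self-adjoint case
  for the dilations.\<close>

lemma mabs_add_morthogonal:
  assumes mn: "0 < m" "0 < n" and u: "u \<in> carrier_mat m n" and v: "v \<in> carrier_mat m n"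
    and orth: "morthogonal V u v"
  shows "mabs V (u + v) = mabs V u + mabs V v"
    "mabs V (mstar V (u + v)) = mabs V (mstar V u) + mabs V (mstar V v)"
proof -
  have uv: "u + v \<in> carrier_mat m n" using u v by simp
  note c = mabs_carrier[OF mn u] mabs_carrier[OF mn v] mabs_carrier[OF mn uv]
    mabs_carrier[OF mn(2,1) mstar_carrier[OF u]] mabs_carrier[OF mn(2,1) mstar_carrier[OF v]]
    mabs_carrier[OF mn(2,1) mstar_carrier[OF uv]]
  have "mabs V (sa_dilation V (u + v)) = mabs V (sa_dilation V u) + mabs V (sa_dilation V v)"
    using mabs_add_orthogonal[OF _ sa_dilation_Msa[OF u] sa_dilation_Msa[OF v]] orth mn
    by (simp add: sa_dilation_add[OF u v] morthogonal_def ao_orthogonal_def)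
  then have "dsum (mabs V (mstar V (u + v))) (mabs V (u + v))
      = dsum (mabs V (mstar V u) + mabs V (mstar V v)) (mabs V u + mabs V v)"
    using dsum_add[OF c(4,5,1,2)]
    by (simp add: mabs_sa_dilation[OF mn u] mabs_sa_dilation[OF mn v] mabs_sa_dilation[OF mn uv])
  then show "mabs V (u + v) = mabs V u + mabs V v"
    "mabs V (mstar V (u + v)) = mabs V (mstar V u) + mabs V (mstar V v)"
    using dsum_inject[of _ m m _ _ n n] c by (metis add_carrier_mat)+
qed

text \<open>If \<open>v\<close> implements the equivalence of \<open>p\<close> and \<open>q\<close>, and \<open>q\<close> is orthogonal to \<open>r\<close>, then the column
  with entries \<open>v\<close> and \<open>r\<close> implements that of \<open>p \<oplus> r\<close> and \<open>q + r\<close>.  Its two parts \<open>u\<close> and \<open>u'\<close> are orthogonal,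
  as their absolute values \<open>q\<close>, \<open>r\<close> are, and those \<open>p \<oplus> 0\<close>, \<open>0 \<oplus> r\<close> of their adjoints.\<close>

lemma proj_equiv_dsum_add:
  assumes n: "0 < n" and OP: "p \<in> OP V n" "q \<in> OP V n" "r \<in> OP V n" "q + r \<in> OP V n"
    and orth: "mabs V (q - r) = q + r" and eq: "proj_equiv V p q"
  shows "proj_equiv V (dsum p r) (q + r)"
proof -
  obtain v where v: "v \<in> carrier_mat n n" "mabs V (mstar V v) = p" "mabs V v = q"
    using proj_equivE[OF eq OP(1,2)] by blast
  have c: "p \<in> carrier_mat n n" "q \<in> carrier_mat n n" "r \<in> carrier_mat n n" using OP OP_carrier by auto
  have rs: "mstar V r = r" using OP_Msa[OF OP(3)] MsaD by blast
  define u u' where "u = lmul V (incl1 n n) v" and "u' = lmul V (incl2 n n) r"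
  have uc: "u \<in> carrier_mat (n + n) n" "u' \<in> carrier_mat (n + n) n"
    unfolding u_def u'_def using lmul_carrier incl_carrier v(1) c(3) by blast+
  have nn: "0 < n + n" using n by simp
  have au: "mabs V u = q" "mabs V u' = r"
    using mabs_lmul_isometry[OF n n nn _ incl_carrier(1) incl1_isometry]
      mabs_lmul_isometry[OF n n nn _ incl_carrier(2) incl2_isometry] v c mabs_OP[OF n OP(3)]
    by (auto simp: u_def u'_def)
  have aus: "mabs V (mstar V u) = dsum p (0\<^sub>m n n)"
  proof -
    have w: "mstar V v \<in> carrier_mat n n" using v by simp
    have us: "mstar V u = rmul V (mstar V v) (mat_adjoint (incl1 n n))"
      unfolding u_def by (rule mstar_lmul[OF incl_carrier(1) v(1)])
    have "mabs V (mstar V u) = mabs V (lmul V (incl1 n n) (mstar V u))"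
      by (rule mabs_lmul_isometry[symmetric, OF n nn nn mstar_carrier[OF uc(1)] incl_carrier(1) incl1_isometry])
    also have "lmul V (incl1 n n) (mstar V u) = dsum (mstar V v) (0\<^sub>m n n)"
      unfolding us conj_by_incl1[OF w, symmetric] conj_by_def
      by (rule rmul_lmul[symmetric, OF incl_carrier(1) w, of _ "n + n"]) auto
    also have "mabs V \<dots> = dsum p (0\<^sub>m n n)"
      using mabs_dsum[OF n n n n w, of "0\<^sub>m n n"] mabs_of_cone[OF n cone_zero[OF n]] v by simp
    finally show ?thesis .
  qed
  have aus': "mabs V (mstar V u') = dsum (0\<^sub>m n n) r"
  proof -
    have us: "mstar V u' = rmul V r (mat_adjoint (incl2 n n))"
      unfolding u'_def using mstar_lmul[OF incl_carrier(2) c(3)] rs by simp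
    have "mabs V (mstar V u') = mabs V (lmul V (incl2 n n) (mstar V u'))"
      by (rule mabs_lmul_isometry[symmetric, OF n nn nn mstar_carrier[OF uc(2)] incl_carrier(2) incl2_isometry])
    also have "lmul V (incl2 n n) (mstar V u') = dsum (0\<^sub>m n n) r"
      unfolding us conj_by_incl2[OF c(3), symmetric] conj_by_def
      by (rule rmul_lmul[symmetric, OF incl_carrier(2) c(3), of _ "n + n"]) auto
    also have "mabs V \<dots> = dsum (0\<^sub>m n n) r"
      using mabs_dsum[OF n n n n _ c(3), of "0\<^sub>m n n"] mabs_of_cone[OF n cone_zero[OF n]]
        mabs_OP[OF n OP(3)] by simp
    finally show ?thesis .
  qed
  have "morthogonal V u u'"
  proof -
    have d: "dsum p (0\<^sub>m n n) \<in> carrier_mat (n + n) (n + n)" "dsum (0\<^sub>m n n) r \<in> carrier_mat (n + n) (n + n)"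
      using c by auto
    have s: "p - 0\<^sub>m n n = p" "0\<^sub>m n n - r = - r" "p + 0\<^sub>m n n = p" "0\<^sub>m n n + r = r"
      using c by (auto intro!: eq_matI)
    have "mabs V (dsum (dsum p (- r)) (q - r)) = dsum (dsum p r) (q + r)"
      using mabs_dsum[OF nn nn n n, of "dsum p (- r)" "q - r"] mabs_dsum[OF n n n n c(1), of "- r"]
        mabs_OP[OF n OP(1)] mabs_uminus[OF n OP_Msa[OF OP(3)]] mabs_OP[OF n OP(3)] orth c
      by (simp add: minus_carrier_mat)
    then show ?thesis
      unfolding morthogonal_def ao_orthogonal_def
        mabs_sa_dilation[OF nn n uc(1)] mabs_sa_dilation[OF nn n uc(2)] au aus aus'
        dsum_minus[OF d c(2,3)] dsum_add[OF d c(2,3)]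
        dsum_minus[OF c(1) zero_carrier_mat zero_carrier_mat c(3)]
        dsum_add[OF c(1) zero_carrier_mat zero_carrier_mat c(3)] s .
  qed
  note sum = mabs_add_morthogonal[OF nn n uc this]
  have "dsum p (0\<^sub>m n n) + dsum (0\<^sub>m n n) r = dsum p r"
    using dsum_add[OF c(1) zero_carrier_mat zero_carrier_mat c(3)] c by simp
  moreover have "dsum p r \<in> OP V (n + n)" using OP_dsum_iff[OF n n c(1,3)] OP by simp
  ultimately show ?thesis
    using sum au aus aus' uc OP(4) by (intro proj_equivI[of "u + u'" "n + n" n]) auto
qed

end


section \<open>Infinite projections\<close>

context absolute_matrix_order_unit_space
begin

lemma OP_nonzero_iff: "p \<in> OP V n - zero_matrices \<longleftrightarrow> p \<in> OP V n \<and> p \<noteq> 0\<^sub>m n n"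
proof -
  have "p = 0\<^sub>m n n" if p: "p \<in> OP V n" and z: "p \<in> zero_matrices"
  proof -
    obtain a b where "p = 0\<^sub>m a b" using z by (auto simp: zero_matrices_def)
    moreover from this have "a = n" "b = n" using carrier_matD[OF OP_carrier[OF p]] by auto
    ultimately show ?thesis by simp
  qed
  then show ?thesis by (auto simp: zero_matrices_def)
qed

lemma infinite_projection_split_iff:
  assumes n: "0 < n" and p: "p \<in> OP V n" "p \<noteq> 0\<^sub>m n n"
  shows "infinite_projection V p \<longleftrightarrow>
    (\<exists>q \<in> OP V n - zero_matrices. \<exists>r \<in> OP V n - zero_matrices.
       ao_orthogonal (mabs V) q r \<and> p = q + r \<and> proj_equiv V p q)"
proof
  assume "infinite_projection V p"
  then obtain q where q: "q \<in> OP V n" "p - q \<in> mcone V n" "q \<noteq> p" "proj_equiv V p q"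
    using infinite_projection_iff[OF n p(1)] by blast
  have c: "p \<in> carrier_mat n n" "q \<in> carrier_mat n n" using OP_carrier p q by auto
  have r: "p - q \<in> OP V n" "mabs V (q - (p - q)) = p"
    using OP_diff[OF n p(1) q(1,2)] by auto
  have "p - q \<noteq> 0\<^sub>m n n" using mat_eq_diff_iff[OF c] q(3) by auto
  moreover have "q \<noteq> 0\<^sub>m n n"
  proof
    assume q0: "q = 0\<^sub>m n n"
    obtain v where v: "v \<in> carrier_mat n n" "mabs V (mstar V v) = p" "mabs V v = q"
      using proj_equivE[OF q(4) p(1) q(1)] by blast
    \<comment> \<open>Only the zero matrix has absolute value zero, so \<open>p\<close> would vanish as well.\<close>
    have "v = 0\<^sub>m n n" using mabs_eq_0D[OF n n v(1)] v(3) q0 by simp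
    then have "p = 0\<^sub>m n n" using v(2) mabs_of_cone[OF n cone_zero[OF n]] by simp
    then show False using p(2) by simp
  qed
  moreover have pqr: "p = q + (p - q)" using c by (intro eq_matI) auto
  moreover have "ao_orthogonal (mabs V) q (p - q)"
    using r pqr mabs_OP[OF n q(1)] mabs_OP[OF n r(1)] by (simp add: ao_orthogonal_def)
  ultimately show "\<exists>q \<in> OP V n - zero_matrices. \<exists>r \<in> OP V n - zero_matrices.
       ao_orthogonal (mabs V) q r \<and> p = q + r \<and> proj_equiv V p q"
    using OP_nonzero_iff q r by blast
next
  assume "\<exists>q \<in> OP V n - zero_matrices. \<exists>r \<in> OP V n - zero_matrices.
       ao_orthogonal (mabs V) q r \<and> p = q + r \<and> proj_equiv V p q"
  then obtain q r where qr: "q \<in> OP V n" "r \<in> OP V n" "r \<noteq> 0\<^sub>m n n" "p = q + r" "proj_equiv V p q"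
    using OP_nonzero_iff by blast
  have c: "q \<in> carrier_mat n n" "r \<in> carrier_mat n n" using OP_carrier qr by auto
  have "p - q = r" using c unfolding qr(4) by (intro eq_matI) auto
  then have "p - q \<in> mcone V n" "q \<noteq> p"
    using OP_cone[OF n qr(2)] qr(3) mat_eq_diff_iff[of p n n q] c qr(4) by auto
  then show "infinite_projection V p"
    using infinite_projection_iff[OF n p(1)] qr by blast
qed

text \<open>From \<open>p = q + r\<close> with \<open>p\<close> equivalent to \<open>q\<close>, the projection \<open>p \<oplus> r\<close> is equivalent to \<open>p\<close> itself.\<close>

lemma dsum_subequiv_if_infinite:
  assumes n: "0 < n" and p: "p \<in> OP V n" "p \<noteq> 0\<^sub>m n n" and inf: "infinite_projection V p"
  shows "\<exists>q \<in> OPinf V - zero_matrices. proj_subequiv V (dsum p q) p"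
proof -
  obtain q r where qr: "q \<in> OP V n" "r \<in> OP V n - zero_matrices"
      "ao_orthogonal (mabs V) q r" "p = q + r" "proj_equiv V p q"
    using infinite_projection_split_iff[OF n p] inf by blast
  have r: "r \<in> OP V n" using qr by blast
  have "mabs V (q - r) = q + r"
    using qr(3) mabs_OP[OF n qr(1)] mabs_OP[OF n r] by (simp add: ao_orthogonal_def)
  then have "proj_equiv V (dsum p r) p"
    using proj_equiv_dsum_add[OF n p(1) qr(1) r] qr(4,5) p(1) by simp
  then have "proj_subequiv V (dsum p r) p"
    using OP_carrier[OF p(1)] p(1) mle_refl[OF n OP_Msa[OF p(1)]]
    by (auto simp: proj_subequiv_def)
  then show ?thesis using qr(2) n by (auto simp: OPinf_def)
qed

text \<open>If \<open>v\<close> implements the equivalence of \<open>p \<oplus> q\<close> and \<open>s \<le> p\<close>, condition (H) cuts from \<open>v\<^sup>*\<close> an orthogonal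
  summand \<open>u\<close> with \<open>|u| = p \<oplus> 0\<close>.  The projection \<open>|u\<^sup>*| \<le> s\<close> is equivalent to \<open>p\<close>, and if it were all of
  \<open>p\<close>, the remainder \<open>v\<^sup>* - u\<close> would vanish, whence \<open>q = 0\<close>.\<close>

lemma infinite_if_dsum_subequiv:
  assumes T: "condition_T V" and H: "condition_H V" and n: "0 < n" and p: "p \<in> OP V n"
    and q: "q \<in> OPinf V - zero_matrices" and sub: "proj_subequiv V (dsum p q) p"
  shows "infinite_projection V p"
proof -
  obtain l where l: "0 < l" and ql: "q \<in> OP V l" using q by (auto simp: OPinf_def)
  have q0: "q \<noteq> 0\<^sub>m l l" using q by (auto simp: zero_matrices_def)
  have nl: "0 < n + l" using n by simp
  have pc: "p \<in> carrier_mat n n" and qc: "q \<in> carrier_mat l l" using OP_carrier p ql by auto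
  have pq: "dsum p q \<in> OP V (n + l)" using OP_dsum_iff[OF n l pc qc] p ql by simp
  have p0: "dsum p (0\<^sub>m l l) \<in> OP V (n + l)" using OP_dsum_iff[OF n l pc] p OP_zero[OF l] by simp
  obtain s where s: "s \<in> OP V n" "proj_equiv V (dsum p q) s" "mle V n s p"
    using sub pc by (auto simp: proj_subequiv_def)
  obtain v where v: "v \<in> ParIso V (n + l) n" "v \<in> carrier_mat (n + l) n"
      "mabs V (mstar V v) = dsum p q" "mabs V v = s"
    using proj_equivE[OF s(2) pq s(1)] by blast
  have le: "mle V (n + l) (dsum p (0\<^sub>m l l)) (mabs V (mstar V v))"
  proof -
    have "q - 0\<^sub>m l l = q" using qc by (intro eq_matI) auto
    then have "dsum p q - dsum p (0\<^sub>m l l) = dsum (0\<^sub>m n n) q"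
      using dsum_minus[OF pc pc qc zero_carrier_mat] pc qc mat_eq_diff_iff[OF pc pc] by simp
    also have "\<dots> = conj_by V (incl2 n l) q" using conj_by_incl2[OF qc] by simp
    also have "\<dots> \<in> mcone V (n + l)" using cone_conj_by[OF nl l] OP_cone[OF l ql] by simp
    finally show ?thesis using OP_Msa[OF pq] OP_Msa[OF p0] v(3) by (simp add: mle_def)
  qed
  have "\<exists>u1 \<in> ParIso V n (n + l). morthogonal V u1 (mstar V v - u1) \<and> dsum p (0\<^sub>m l l) = mabs V u1"
    using H[unfolded condition_H_def, rule_format, OF n nl ParIso_mstar[OF v(1)] p0 le] .
  then obtain u where u: "u \<in> ParIso V n (n + l)" "morthogonal V u (mstar V v - u)"
      "mabs V u = dsum p (0\<^sub>m l l)" by auto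
  have uc: "u \<in> carrier_mat n (n + l)" using u(1) by (simp add: ParIso_def)
  define d where "d = mstar V v - u"
  have dc: "d \<in> carrier_mat n (n + l)" using uc v(2) by (simp add: d_def minus_carrier_mat)
  have ud: "u + d = mstar V v" using uc v(2) unfolding d_def by (intro eq_matI) auto
  let ?s = "mabs V (mstar V u)" and ?t = "mabs V (mstar V d)"
  have sum: "s = ?s + ?t"
    using mabs_add_morthogonal(2)[OF n nl uc dc] u(2) v(4) unfolding ud by (simp add: d_def)
  have s1: "?s \<in> OP V n" using u(1) by (simp add: ParIso_def)
  have tc: "?t \<in> mcone V n" by (rule mabs_cone[OF nl n mstar_carrier[OF dc]])
  have c: "?s \<in> carrier_mat n n" "?t \<in> carrier_mat n n" "s \<in> carrier_mat n n"
    using OP_carrier[OF s1] cone_carrier[OF n tc] OP_carrier[OF s(1)] by auto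
  have st: "s - ?s = ?t" using c unfolding sum by (intro eq_matI) auto
  have s1s: "mle V n ?s s" using st tc OP_Msa[OF s1] OP_Msa[OF s(1)] by (simp add: mle_def)
  then have "p - ?s \<in> mcone V n" using mle_trans[OF n s1s s(3)] by (simp add: mle_def)
  moreover have "?s \<noteq> p"
  proof
    assume "?s = p"
    then have "s = ?s" using mle_antisym[OF n s(3)] s1s by simp
    then have "?t = 0\<^sub>m n n" using st mat_eq_diff_iff[OF c(3,1)] by simp
    then have "mstar V d = 0\<^sub>m (n + l) n" using mabs_eq_0D[OF nl n mstar_carrier[OF dc]] by simp
    then have "d = 0\<^sub>m n (n + l)" using mstar_mstar[of d] by simp
    then have "mstar V v = u"
      using mat_eq_diff_iff[OF mstar_carrier[OF v(2)] uc] by (simp add: d_def)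
    then have "dsum p q = dsum p (0\<^sub>m l l)" using v(3) u(3) by simp
    then show False using dsum_inject(2)[OF pc pc qc zero_carrier_mat] q0 by simp
  qed
  moreover have "proj_equiv V p ?s"
  proof (rule proj_equiv_trans[OF T n nl n p p0 s1])
    show "proj_equiv V p (dsum p (0\<^sub>m l l))"
      using proj_equiv_conj_by[OF nl n incl_carrier(1) incl1_isometry p] conj_by_incl1[OF pc] by simp
    show "proj_equiv V (dsum p (0\<^sub>m l l)) ?s"
      by (rule proj_equivI[OF mstar_carrier[OF uc] p0 s1]) (auto simp: u(3))
  qed
  ultimately show ?thesis using infinite_projection_iff[OF n p] s1 by blast
qed

end

theorem theorem5p5:
  fixes V :: "'v::ab_group_add matrix_space" and p :: "'v mat" and n k :: nat
  assumes "absolute_matrix_order_unit_space V"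
    and "condition_T V"
    and "0 < n" and "0 < k"
    and "p \<in> OP V n - zero_matrices"
  shows
    "(infinite_projection V p \<longleftrightarrow>
        (\<exists>q \<in> OP V n - zero_matrices. \<exists>r \<in> OP V n - zero_matrices.
           ao_orthogonal (mabs V) q r \<and> p = q + r \<and> proj_equiv V p q)) \<and>
     (infinite_projection V p \<longleftrightarrow> infinite_projection V (dsum p (0\<^sub>m k k))) \<and>
     (infinite_projection V p \<longleftrightarrow> infinite_projection V (dsum (0\<^sub>m k k) p)) \<and>
     (infinite_projection V p \<longleftrightarrow>
        (\<forall>m>0. \<forall>\<alpha> \<in> carrier_mat m n. mat_adjoint \<alpha> * \<alpha> = 1\<^sub>m n \<longrightarrow>
           infinite_projection V (rmul V (lmul V \<alpha> p) (mat_adjoint \<alpha>)))) \<and>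
     (condition_H V \<longrightarrow>
        (infinite_projection V p \<longleftrightarrow>
           (\<exists>q \<in> OPinf V - zero_matrices. proj_subequiv V (dsum p q) p)))"
proof -
  interpret absolute_matrix_order_unit_space V by (rule assms(1))
  note T = assms(2) and n = assms(3) and k = assms(4)
  have p: "p \<in> OP V n" "p \<noteq> 0\<^sub>m n n" using assms(5) OP_nonzero_iff by blast+
  note pc = OP_carrier[OF p(1)]
  have nk: "0 < n + k" "0 < k + n" using n by auto
  show ?thesis
  proof (intro conjI impI)
    show "infinite_projection V p \<longleftrightarrow>
        (\<exists>q \<in> OP V n - zero_matrices. \<exists>r \<in> OP V n - zero_matrices.
           ao_orthogonal (mabs V) q r \<and> p = q + r \<and> proj_equiv V p q)"
      by (rule infinite_projection_split_iff[OF n p])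
    show "infinite_projection V p \<longleftrightarrow> infinite_projection V (dsum p (0\<^sub>m k k))"
      using infinite_projection_conj_by_iff[OF T nk(1) n incl_carrier(1) incl1_isometry p(1)]
      by (simp add: conj_by_incl1[OF pc])
    show "infinite_projection V p \<longleftrightarrow> infinite_projection V (dsum (0\<^sub>m k k) p)"
      using infinite_projection_conj_by_iff[OF T nk(2) n incl_carrier(2) incl2_isometry p(1)]
      by (simp add: conj_by_incl2[OF pc])
    have "infinite_projection V (rmul V (lmul V \<alpha> p) (mat_adjoint \<alpha>)) \<longleftrightarrow> infinite_projection V p"
      if "0 < m" "\<alpha> \<in> carrier_mat m n" "mat_adjoint \<alpha> * \<alpha> = 1\<^sub>m n" for m \<alpha>
      using infinite_projection_conj_by_iff[OF T that(1) n that(2,3) p(1)]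
      by (simp add: conj_by_def)
    \<comment> \<open>The identity matrix is one of the isometries, so the universal statement returns to \<open>p\<close>.\<close>
    moreover have "mat_adjoint (1\<^sub>m n :: complex mat) * 1\<^sub>m n = 1\<^sub>m n" by simp
    ultimately show "infinite_projection V p \<longleftrightarrow>
        (\<forall>m>0. \<forall>\<alpha> \<in> carrier_mat m n. mat_adjoint \<alpha> * \<alpha> = 1\<^sub>m n \<longrightarrow>
           infinite_projection V (rmul V (lmul V \<alpha> p) (mat_adjoint \<alpha>)))"
      using n one_carrier_mat[of n] by meson
    assume "condition_H V"
    then show "infinite_projection V p \<longleftrightarrow>
        (\<exists>q \<in> OPinf V - zero_matrices. proj_subequiv V (dsum p q) p)"
      using dsum_subequiv_if_infinite[OF n p] infinite_if_dsum_subequiv[OF T _ n p(1)] by blast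
  qed
qed

end
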